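(* Let $\xi\in\mathbb C/2\mathbb Z$ and $\tau\in\mathbb C$ be such that $\tau\ne(\mu+1)^2$ for all $\mu\in\xi$ and $\tau\neq 0$. A square root $\sqrt\tau\in\mathbb C$ of $\tau$ determines a fully faithful functor $$F_{\sqrt\tau}:\bar{\mathfrak M}^{\xi,\tau}\longrightarrow \mathbf{Witt}_{>}\text{-mod}$$ such that $G\circ F_{\sqrt\tau}=\operatorname{Id}_{\bar{\mathfrak M}^{\xi,\tau}}$, where $G:\mathbf{Witt}_{>}\text{-mod}\to\mathfrak{sl}(2)\text{-mod}$ is the forgetful functor (restriction along $\mathfrak{sl}(2)\hookrightarrow\mathbf{Witt}_{>}$) and the equality means that $G\circ F_{\sqrt\tau}$ is the inclusion of the full subcategory $\bar{\mathfrak M}^{\xi,\tau}$ into $\mathfrak{sl}(2)\text{-mod}$.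
   Context: $\mathfrak{sl}(2)=\mathfrak{sl}(2,\mathbb C)$ has Chevalley basis $\{e,f,h\}$ with $[e,f]=h$, $[h,e]=2e$, $[h,f]=-2f$. $\mathbf{Witt}_{>}$ is the complex Lie algebra with basis $\{L_k\}_{k\ge-1}$ and bracket $[L_i,L_j]=(i-j)L_{i+j}$; $\mathfrak{sl}(2)$ is embedded in it by $f\mapsto L_{-1}$, $h\mapsto-2L_0$, $e\mapsto-L_1$. The Casimir operator is $c=(h+1)^2+4fe$. For an $\mathfrak{sl}(2)$-module $M$ and $\lambda\in\mathbb C$, $M_\lambda=\{m\in M: hm=\lambda m\}$; $M$ is a weight module if $M=\bigoplus_\lambda M_\lambda$, and $\operatorname{supp}(M)=\{\lambda: M_\lambda\neq0\}$. A class $\xi\in\mathbb C/2\mathbb Z$ is regarded as a subset of $\mathbb C$. $\bar{\mathfrak M}^{\xi,\tau}$ is the full subcategory of $\mathfrak{sl}(2)$-modules whose objects are the weight modules $M$ with finite-dimensional weight spaces, $\operatorname{supp}(M)\subseteq\xi$, and such that $(c-\tau)|_{M_\lambda}$ is nilpotent for every $\lambda\in\xi$. *)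

theory Defs
  imports
    "HOL-Analysis.Analysis"
    "HOL-Algebra.Algebraic_Closure_Type"
    "HOL-Library.Poly_Mapping"
begin

section \<open>Categories and functors\<close>

text \<open>
  A morphism is not required to know its domain and codomain; hence composition and the action
  of a functor on morphisms take the objects involved as additional arguments.
\<close>

record ('o, 'm) category =
  Ob :: "'o set"
  Hom :: "'o \<Rightarrow> 'o \<Rightarrow> 'm set"
  Idn :: "'o \<Rightarrow> 'm"
  Cmp :: "'o \<Rightarrow> 'o \<Rightarrow> 'o \<Rightarrow> 'm \<Rightarrow> 'm \<Rightarrow> 'm"

definition is_category :: "('o, 'm) category \<Rightarrow> bool" where
  "is_category C \<longleftrightarrow>
     (\<forall>a\<in>Ob C. Idn C a \<in> Hom C a a) \<and>
     (\<forall>a\<in>Ob C. \<forall>b\<in>Ob C. \<forall>c\<in>Ob C. \<forall>f\<in>Hom C a b. \<forall>g\<in>Hom C b c.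
        Cmp C a b c g f \<in> Hom C a c) \<and>
     (\<forall>a\<in>Ob C. \<forall>b\<in>Ob C. \<forall>f\<in>Hom C a b.
        Cmp C a a b f (Idn C a) = f \<and> Cmp C a b b (Idn C b) f = f) \<and>
     (\<forall>d\<in>Ob C. \<forall>a\<in>Ob C. \<forall>b\<in>Ob C. \<forall>c\<in>Ob C.
        \<forall>f\<in>Hom C d a. \<forall>g\<in>Hom C a b. \<forall>h\<in>Hom C b c.
          Cmp C d a c (Cmp C a b c h g) f = Cmp C d b c h (Cmp C d a b g f))"

definition full_subcategory :: "('o, 'm) category \<Rightarrow> ('o \<Rightarrow> bool) \<Rightarrow> ('o, 'm) category" where
  "full_subcategory C P = C\<lparr>Ob := {a \<in> Ob C. P a}\<rparr>"

record ('o1, 'm1, 'o2, 'm2) ftor =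
  on_ob :: "'o1 \<Rightarrow> 'o2"
  on_hom :: "'o1 \<Rightarrow> 'o1 \<Rightarrow> 'm1 \<Rightarrow> 'm2"

definition is_functor ::
  "('o1, 'm1) category \<Rightarrow> ('o2, 'm2) category \<Rightarrow> ('o1, 'm1, 'o2, 'm2) ftor \<Rightarrow> bool" where
  "is_functor C D F \<longleftrightarrow>
     (\<forall>a\<in>Ob C. on_ob F a \<in> Ob D) \<and>
     (\<forall>a\<in>Ob C. \<forall>b\<in>Ob C. \<forall>f\<in>Hom C a b.
        on_hom F a b f \<in> Hom D (on_ob F a) (on_ob F b)) \<and>
     (\<forall>a\<in>Ob C. on_hom F a a (Idn C a) = Idn D (on_ob F a)) \<and>
     (\<forall>a\<in>Ob C. \<forall>b\<in>Ob C. \<forall>c\<in>Ob C. \<forall>f\<in>Hom C a b. \<forall>g\<in>Hom C b c.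
        on_hom F a c (Cmp C a b c g f) =
          Cmp D (on_ob F a) (on_ob F b) (on_ob F c) (on_hom F b c g) (on_hom F a b f))"

definition fully_faithful ::
  "('o1, 'm1) category \<Rightarrow> ('o2, 'm2) category \<Rightarrow> ('o1, 'm1, 'o2, 'm2) ftor \<Rightarrow> bool" where
  "fully_faithful C D F \<longleftrightarrow>
     (\<forall>a\<in>Ob C. \<forall>b\<in>Ob C.
        bij_betw (on_hom F a b) (Hom C a b) (Hom D (on_ob F a) (on_ob F b)))"

definition functor_comp ::
  "('o2, 'm2, 'o3, 'm3) ftor \<Rightarrow> ('o1, 'm1, 'o2, 'm2) ftor \<Rightarrow> ('o1, 'm1, 'o3, 'm3) ftor" where
  "functor_comp G F =
     \<lparr>on_ob = (\<lambda>a. on_ob G (on_ob F a)),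
      on_hom = (\<lambda>a b f. on_hom G (on_ob F a) (on_ob F b) (on_hom F a b f))\<rparr>"

definition inclusion_functor :: "('o, 'm, 'o, 'm) ftor" where
  "inclusion_functor = \<lparr>on_ob = (\<lambda>a. a), on_hom = (\<lambda>a b f. f)\<rparr>"

text \<open>Strict equality of functors out of \<^term>\<open>C\<close> (not merely a natural isomorphism).\<close>

definition functor_eq ::
  "('o1, 'm1) category \<Rightarrow> ('o1, 'm1, 'o2, 'm2) ftor \<Rightarrow> ('o1, 'm1, 'o2, 'm2) ftor \<Rightarrow> bool" where
  "functor_eq C F G \<longleftrightarrow>
     (\<forall>a\<in>Ob C. on_ob F a = on_ob G a) \<and>
     (\<forall>a\<in>Ob C. \<forall>b\<in>Ob C. \<forall>f\<in>Hom C a b. on_hom F a b f = on_hom G a b f)"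


section \<open>Complex Lie algebras and their modules\<close>

text \<open>
  A complex vector space is a module in the sense of HOL-Algebra over the following ring; the
  record fields \<^const>\<open>monoid.mult\<close> and \<^const>\<open>monoid.one\<close> of the module itself are irrelevant.
\<close>

abbreviation complex_field :: "complex ring" where
  "complex_field \<equiv> ring_of_type_algebra"

lemma complex_field_simps [simp]:
  "carrier complex_field = UNIV" "monoid.mult complex_field = (*)" "one complex_field = 1"
  "zero complex_field = 0" "add complex_field = (+)"
  by (simp_all add: ring_of_type_algebra_def)

record 'g lie_algebra = "(complex, 'g) module" +
  bracket :: "'g \<Rightarrow> 'g \<Rightarrow> 'g"

definition is_lie_algebra :: "'g lie_algebra \<Rightarrow> bool" where
  "is_lie_algebra \<gg> \<longleftrightarrow>
     Module.module complex_field \<gg> \<and>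
     (\<forall>x\<in>carrier \<gg>. \<forall>y\<in>carrier \<gg>. bracket \<gg> x y \<in> carrier \<gg>) \<and>
     (\<forall>x\<in>carrier \<gg>. \<forall>y\<in>carrier \<gg>. \<forall>z\<in>carrier \<gg>.
        bracket \<gg> (x \<oplus>\<^bsub>\<gg>\<^esub> y) z = bracket \<gg> x z \<oplus>\<^bsub>\<gg>\<^esub> bracket \<gg> y z \<and>
        bracket \<gg> z (x \<oplus>\<^bsub>\<gg>\<^esub> y) = bracket \<gg> z x \<oplus>\<^bsub>\<gg>\<^esub> bracket \<gg> z y) \<and>
     (\<forall>a. \<forall>x\<in>carrier \<gg>. \<forall>y\<in>carrier \<gg>.
        bracket \<gg> (a \<odot>\<^bsub>\<gg>\<^esub> x) y = a \<odot>\<^bsub>\<gg>\<^esub> bracket \<gg> x y \<and>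
        bracket \<gg> x (a \<odot>\<^bsub>\<gg>\<^esub> y) = a \<odot>\<^bsub>\<gg>\<^esub> bracket \<gg> x y) \<and>
     (\<forall>x\<in>carrier \<gg>. bracket \<gg> x x = \<zero>\<^bsub>\<gg>\<^esub>) \<and>
     (\<forall>x\<in>carrier \<gg>. \<forall>y\<in>carrier \<gg>. \<forall>z\<in>carrier \<gg>.
        bracket \<gg> x (bracket \<gg> y z) \<oplus>\<^bsub>\<gg>\<^esub> bracket \<gg> y (bracket \<gg> z x)
          \<oplus>\<^bsub>\<gg>\<^esub> bracket \<gg> z (bracket \<gg> x y) = \<zero>\<^bsub>\<gg>\<^esub>)"

definition is_lie_hom :: "'g lie_algebra \<Rightarrow> 'h lie_algebra \<Rightarrow> ('g \<Rightarrow> 'h) \<Rightarrow> bool" where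
  "is_lie_hom \<gg> \<hh> \<phi> \<longleftrightarrow>
     \<phi> \<in> carrier \<gg> \<rightarrow> carrier \<hh> \<and>
     (\<forall>x\<in>carrier \<gg>. \<forall>y\<in>carrier \<gg>. \<phi> (x \<oplus>\<^bsub>\<gg>\<^esub> y) = \<phi> x \<oplus>\<^bsub>\<hh>\<^esub> \<phi> y) \<and>
     (\<forall>a. \<forall>x\<in>carrier \<gg>. \<phi> (a \<odot>\<^bsub>\<gg>\<^esub> x) = a \<odot>\<^bsub>\<hh>\<^esub> \<phi> x) \<and>
     (\<forall>x\<in>carrier \<gg>. \<forall>y\<in>carrier \<gg>. \<phi> (bracket \<gg> x y) = bracket \<hh> (\<phi> x) (\<phi> y))"

record ('g, 'v) lie_rep = "(complex, 'v) module" +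
  act :: "'g \<Rightarrow> 'v \<Rightarrow> 'v"

text \<open>
  The two extensionality conditions fix the value of the action outside the carriers, so that
  equality of modules is not affected by meaningless values.
\<close>

definition is_lie_rep :: "'g lie_algebra \<Rightarrow> ('g, 'v) lie_rep \<Rightarrow> bool" where
  "is_lie_rep \<gg> M \<longleftrightarrow>
     Module.module complex_field M \<and>
     act M \<in> extensional (carrier \<gg>) \<and>
     (\<forall>x\<in>carrier \<gg>. act M x \<in> carrier M \<rightarrow>\<^sub>E carrier M) \<and>
     (\<forall>x\<in>carrier \<gg>. \<forall>m\<in>carrier M. \<forall>n\<in>carrier M.
        act M x (m \<oplus>\<^bsub>M\<^esub> n) = act M x m \<oplus>\<^bsub>M\<^esub> act M x n) \<and>
     (\<forall>a. \<forall>x\<in>carrier \<gg>. \<forall>m\<in>carrier M.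
        act M x (a \<odot>\<^bsub>M\<^esub> m) = a \<odot>\<^bsub>M\<^esub> act M x m) \<and>
     (\<forall>x\<in>carrier \<gg>. \<forall>y\<in>carrier \<gg>. \<forall>m\<in>carrier M.
        act M (x \<oplus>\<^bsub>\<gg>\<^esub> y) m = act M x m \<oplus>\<^bsub>M\<^esub> act M y m) \<and>
     (\<forall>a. \<forall>x\<in>carrier \<gg>. \<forall>m\<in>carrier M.
        act M (a \<odot>\<^bsub>\<gg>\<^esub> x) m = a \<odot>\<^bsub>M\<^esub> act M x m) \<and>
     (\<forall>x\<in>carrier \<gg>. \<forall>y\<in>carrier \<gg>. \<forall>m\<in>carrier M.
        act M (bracket \<gg> x y) m = act M x (act M y m) \<ominus>\<^bsub>M\<^esub> act M y (act M x m))"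

definition rep_homs ::
  "'g lie_algebra \<Rightarrow> ('g, 'v) lie_rep \<Rightarrow> ('g, 'v) lie_rep \<Rightarrow> ('v \<Rightarrow> 'v) set" where
  "rep_homs \<gg> M N =
     {\<phi> \<in> carrier M \<rightarrow>\<^sub>E carrier N.
        (\<forall>m\<in>carrier M. \<forall>n\<in>carrier M. \<phi> (m \<oplus>\<^bsub>M\<^esub> n) = \<phi> m \<oplus>\<^bsub>N\<^esub> \<phi> n) \<and>
        (\<forall>a. \<forall>m\<in>carrier M. \<phi> (a \<odot>\<^bsub>M\<^esub> m) = a \<odot>\<^bsub>N\<^esub> \<phi> m) \<and>
        (\<forall>x\<in>carrier \<gg>. \<forall>m\<in>carrier M. \<phi> (act M x m) = act N x (\<phi> m))}"

text \<open>
  The underlying sets of the modules are arbitrary subsets of the type \<^typ>\<open>'v\<close>, which plays the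
  role of the universe.
\<close>

definition lie_mod :: "'g lie_algebra \<Rightarrow> (('g, 'v) lie_rep, 'v \<Rightarrow> 'v) category" where
  "lie_mod \<gg> =
     \<lparr>Ob = {M. is_lie_rep \<gg> M},
      Hom = rep_homs \<gg>,
      Idn = (\<lambda>M. restrict (\<lambda>m. m) (carrier M)),
      Cmp = (\<lambda>L M N \<psi> \<phi>. compose (carrier L) \<psi> \<phi>)\<rparr>"

definition restriction_functor ::
  "'g lie_algebra \<Rightarrow> ('g \<Rightarrow> 'h) \<Rightarrow>
     (('h, 'v) lie_rep, 'v \<Rightarrow> 'v, ('g, 'v) lie_rep, 'v \<Rightarrow> 'v) ftor" where
  "restriction_functor \<gg> \<phi> =
     \<lparr>on_ob = (\<lambda>M. \<lparr>carrier = carrier M, monoid.mult = monoid.mult M, one = one M,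
                     zero = zero M, add = add M, smult = smult M,
                     act = (\<lambda>x\<in>carrier \<gg>. act M (\<phi> x))\<rparr>),
      on_hom = (\<lambda>M N f. f)\<rparr>"

lemma is_category_lie_mod: "is_category (lie_mod \<gg> :: (('g, 'v) lie_rep, 'v \<Rightarrow> 'v) category)"
  unfolding is_category_def lie_mod_def
proof (simp, intro conjI ballI allI impI)
  fix L :: "('g, 'v) lie_rep" assume "is_lie_rep \<gg> L"
  then interpret Module.module complex_field L by (simp add: is_lie_rep_def)
  show "restrict (\<lambda>m. m) (carrier L) \<in> rep_homs \<gg> L L"
    using \<open>is_lie_rep \<gg> L\<close>
    by (auto simp: rep_homs_def is_lie_rep_def ring_of_type_algebra_def PiE_iff Pi_iff
        smult_closed[unfolded ring_of_type_algebra_def, simplified])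
next
  fix L M N :: "('g, 'v) lie_rep" and f g
  assume *: "is_lie_rep \<gg> L" "f \<in> rep_homs \<gg> L M" "g \<in> rep_homs \<gg> M N"
  then interpret Module.module complex_field L by (simp add: is_lie_rep_def)
  show "compose (carrier L) g f \<in> rep_homs \<gg> L N"
    using * smult_closed[unfolded ring_of_type_algebra_def, simplified]
    by (auto simp: rep_homs_def is_lie_rep_def PiE_iff Pi_iff compose_def)
next
  fix L M :: "('g, 'v) lie_rep" and f
  assume "f \<in> rep_homs \<gg> L M"
  then show "compose (carrier L) f (restrict (\<lambda>m. m) (carrier L)) = f"
    "compose (carrier L) (restrict (\<lambda>m. m) (carrier M)) f = f"
    by (auto simp: rep_homs_def PiE_iff Pi_iff compose_def fun_eq_iff extensional_def)
next
  fix K L M N :: "('g, 'v) lie_rep" and f g h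
  assume "f \<in> rep_homs \<gg> K L" "g \<in> rep_homs \<gg> L M" "h \<in> rep_homs \<gg> M N"
  then show "compose (carrier K) (compose (carrier L) h g) f
      = compose (carrier K) h (compose (carrier K) g f)"
    by (auto simp: rep_homs_def PiE_iff Pi_iff compose_def fun_eq_iff)
qed

lemma is_functor_restriction:
  assumes "is_lie_hom \<gg> \<hh> \<phi>" "is_lie_algebra \<gg>"
  shows "is_functor (lie_mod \<hh>) (lie_mod \<gg>) (restriction_functor \<gg> \<phi>)"
proof -
  have ob: "is_lie_rep \<gg> (on_ob (restriction_functor \<gg> \<phi>) M)" if M: "is_lie_rep \<hh> M" for M :: "('b, 'c) lie_rep"
  proof -
    interpret gg: Module.module complex_field \<gg> using assms by (simp add: is_lie_algebra_def)
    let ?N = "on_ob (restriction_functor \<gg> \<phi>) M"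
    interpret Module.module complex_field M using M by (simp add: is_lie_rep_def)
    have "abelian_group ?N"
    proof (rule abelian_groupI, goal_cases)
      case (6 x)
      then show ?case
        by (intro bexI[of _ "\<ominus>\<^bsub>M\<^esub> x"]) (auto simp: restriction_functor_def l_neg)
    qed (auto simp: restriction_functor_def a_ac)
    then have "Module.module complex_field ?N"
      by (intro Module.moduleI cring_from_type_algebra)
         (use smult_l_distr smult_r_distr smult_assoc1 smult_one smult_closed in \<open>auto simp: restriction_functor_def\<close>)
    moreover have "x \<ominus>\<^bsub>?N\<^esub> y = x \<ominus>\<^bsub>M\<^esub> y" for x y
      by (simp add: a_minus_def a_inv_def m_inv_def restriction_functor_def)
    ultimately show ?thesis
      using M assms gg.smult_closed gg.a_closed unfolding is_lie_rep_def is_lie_hom_def is_lie_algebra_def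
      by (simp add: restriction_functor_def Pi_iff)
  qed
  then show ?thesis using assms(1)
    unfolding is_functor_def
    by (simp add: lie_mod_def) (auto simp: restriction_functor_def rep_homs_def is_lie_hom_def Pi_iff)
qed


section \<open>The Lie algebras $\mathfrak{sl}(2)$ and $\mathrm{Witt}_>$\<close>

definition sl2 :: "(complex^2^2) lie_algebra" where
  "sl2 = \<lparr>carrier = {A. trace A = 0}, monoid.mult = undefined, one = undefined,
          zero = 0, add = (+), smult = (\<lambda>a A. \<chi> i j. a * A $ i $ j),
          bracket = (\<lambda>A B. A ** B - B ** A)\<rparr>"

definition sl2_e :: "complex^2^2" where "sl2_e = vector [vector [0, 1], vector [0, 0]]"
definition sl2_f :: "complex^2^2" where "sl2_f = vector [vector [0, 0], vector [1, 0]]"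
definition sl2_h :: "complex^2^2" where "sl2_h = vector [vector [1, 0], vector [0, -1]]"

text \<open>
  The finitely supported function \<^term>\<open>x\<close> represents $\sum_k x(k) L_k$.
\<close>

definition witt_L :: "int \<Rightarrow> (int \<Rightarrow>\<^sub>0 complex)" where
  "witt_L k = Poly_Mapping.single k 1"

definition witt :: "(int \<Rightarrow>\<^sub>0 complex) lie_algebra" where
  "witt = \<lparr>carrier = {x. Poly_Mapping.keys x \<subseteq> {-1..}},
           monoid.mult = undefined, one = undefined,
           zero = 0, add = (+), smult = (\<lambda>a. Poly_Mapping.map ((*) a)),
           bracket = (\<lambda>x y. \<Sum>i\<in>Poly_Mapping.keys x. \<Sum>j\<in>Poly_Mapping.keys y.
             Poly_Mapping.single (i + j)
               (of_int (i - j) * Poly_Mapping.lookup x i * Poly_Mapping.lookup y j))\<rparr>"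

text \<open>The linear map with $f \mapsto L_{-1}$, $h \mapsto -2 L_0$, $e \mapsto -L_1$.\<close>

definition sl2_to_witt :: "complex^2^2 \<Rightarrow> (int \<Rightarrow>\<^sub>0 complex)" where
  "sl2_to_witt A = Poly_Mapping.single (-1) (A $ 2 $ 1) + Poly_Mapping.single 0 (- 2 * A $ 1 $ 1)
     + Poly_Mapping.single 1 (- (A $ 1 $ 2))"

definition forget_functor ::
  "((int \<Rightarrow>\<^sub>0 complex, 'v) lie_rep, 'v \<Rightarrow> 'v, (complex^2^2, 'v) lie_rep, 'v \<Rightarrow> 'v) ftor" where
  "forget_functor = restriction_functor sl2 sl2_to_witt"

lemma sl2_basis:
  "sl2_e \<in> carrier sl2" "sl2_f \<in> carrier sl2" "sl2_h \<in> carrier sl2"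
  "bracket sl2 sl2_e sl2_f = sl2_h"
  "bracket sl2 sl2_h sl2_e = 2 \<odot>\<^bsub>sl2\<^esub> sl2_e"
  "bracket sl2 sl2_h sl2_f = (-2) \<odot>\<^bsub>sl2\<^esub> sl2_f"
  by (simp_all add: sl2_def sl2_e_def sl2_f_def sl2_h_def trace_def sum_2 vec_eq_iff forall_2
      matrix_matrix_mult_def)

lemma witt_bracket_L: "bracket witt (witt_L i) (witt_L j) = (of_int (i - j)) \<odot>\<^bsub>witt\<^esub> witt_L (i + j)"
  by (simp add: witt_def witt_L_def)

lemma sl2_to_witt_basis:
  "sl2_to_witt sl2_f = witt_L (-1)"
  "sl2_to_witt sl2_h = (-2) \<odot>\<^bsub>witt\<^esub> witt_L 0"
  "sl2_to_witt sl2_e = (-1) \<odot>\<^bsub>witt\<^esub> witt_L 1"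
  by (simp_all del: single_one add: sl2_to_witt_def witt_L_def witt_def sl2_e_def sl2_f_def sl2_h_def)

lemma is_lie_algebra_sl2: "is_lie_algebra sl2"
proof -
  have tr: "trace (x + y) = trace x + trace y" "trace (x - y) = trace x - trace y" "trace (- x) = - trace x"
    "trace (x ** y) = trace (y ** x)" "trace (\<chi> i j. a * x $ i $ j) = a * trace x"
    for x y :: "complex^2^2" and a
    by (simp_all add: trace_def sum_2 algebra_simps matrix_matrix_mult_def)
  have "abelian_group sl2"
  proof (rule abelian_groupI, goal_cases)
    case (6 x)
    then show ?case
      by (intro bexI[of _ "- x"]) (auto simp: sl2_def tr)
  qed (auto simp: sl2_def tr trace_0[simplified mat_def] algebra_simps; simp add: trace_def)+
  then have "Module.module complex_field sl2"
    by (intro Module.moduleI cring_from_type_algebra)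
       (auto simp: sl2_def tr vec_eq_iff algebra_simps)
  moreover have "bracket sl2 x y \<in> carrier sl2" for x y
    by (simp add: sl2_def tr(2) tr(4)[of x y])
  ultimately show ?thesis
    unfolding is_lie_algebra_def
    by (simp, simp add: sl2_def vec_eq_iff forall_2 matrix_matrix_mult_def sum_2 algebra_simps)
qed

text \<open>
  With the convolution product, the type \<^typ>\<open>int \<Rightarrow>\<^sub>0 complex\<close> is the ring of Laurent polynomials;
  the following is its degree derivation.
\<close>

definition witt_deg :: "(int \<Rightarrow>\<^sub>0 complex) \<Rightarrow> (int \<Rightarrow>\<^sub>0 complex)" where
  "witt_deg = Poly_Mapping.mapp (\<lambda>k a. of_int k * a)"

lemma lookup_witt_deg: "Poly_Mapping.lookup (witt_deg x) k = of_int k * Poly_Mapping.lookup x k"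
  by (simp add: witt_deg_def lookup_mapp when_def in_keys_iff)

lemma witt_deg_single: "witt_deg (Poly_Mapping.single k a) = Poly_Mapping.single k (of_int k * a)"
  by (rule poly_mapping_eqI) (simp add: lookup_witt_deg lookup_single when_def)

lemma witt_deg_add: "witt_deg (x + y) = witt_deg x + witt_deg y"
  by (rule poly_mapping_eqI) (simp add: lookup_witt_deg lookup_add algebra_simps)

lemma witt_deg_diff: "witt_deg (x - y) = witt_deg x - witt_deg y"
  by (rule poly_mapping_eqI) (simp add: lookup_witt_deg lookup_minus algebra_simps)

lemma witt_deg_0: "witt_deg 0 = 0"
  by (rule poly_mapping_eqI) (simp add: lookup_witt_deg)

lemma witt_deg_sum: "witt_deg (sum f S) = (\<Sum>i\<in>S. witt_deg (f i))"
  by (induction S rule: infinite_finite_induct) (auto simp: witt_deg_0 witt_deg_add)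

lemma witt_decomp:
  fixes x :: "int \<Rightarrow>\<^sub>0 complex"
  shows "x = (\<Sum>i\<in>Poly_Mapping.keys x. Poly_Mapping.single i (Poly_Mapping.lookup x i))"
  by (rule poly_mapping_eqI) (auto simp: lookup_sum lookup_single when_def in_keys_iff)

lemma witt_deg_mult: "witt_deg (x * y) = witt_deg x * y + x * witt_deg y"
proof -
  have "witt_deg (x * y) = witt_deg ((\<Sum>i\<in>Poly_Mapping.keys x. Poly_Mapping.single i (Poly_Mapping.lookup x i)) * (\<Sum>i\<in>Poly_Mapping.keys y. Poly_Mapping.single i (Poly_Mapping.lookup y i)))"
    using witt_decomp by metis
  also have "\<dots> = witt_deg (\<Sum>i\<in>Poly_Mapping.keys x. Poly_Mapping.single i (Poly_Mapping.lookup x i)) * (\<Sum>i\<in>Poly_Mapping.keys y. Poly_Mapping.single i (Poly_Mapping.lookup y i)) + (\<Sum>i\<in>Poly_Mapping.keys x. Poly_Mapping.single i (Poly_Mapping.lookup x i)) * witt_deg (\<Sum>i\<in>Poly_Mapping.keys y. Poly_Mapping.single i (Poly_Mapping.lookup y i))"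
    by (simp add: witt_deg_sum sum_product mult_single witt_deg_single flip: sum.distrib)
       (simp add: algebra_simps flip: single_add)
  also have "\<dots> = witt_deg x * y + x * witt_deg y" using witt_decomp by metis
  finally show ?thesis .
qed

lemma witt_bracket_eq: "bracket witt x y = witt_deg x * y - x * witt_deg y"
proof -
  have "witt_deg x * y - x * witt_deg y = witt_deg (\<Sum>i\<in>Poly_Mapping.keys x. Poly_Mapping.single i (Poly_Mapping.lookup x i)) * (\<Sum>i\<in>Poly_Mapping.keys y. Poly_Mapping.single i (Poly_Mapping.lookup y i)) - (\<Sum>i\<in>Poly_Mapping.keys x. Poly_Mapping.single i (Poly_Mapping.lookup x i)) * witt_deg (\<Sum>i\<in>Poly_Mapping.keys y. Poly_Mapping.single i (Poly_Mapping.lookup y i))"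
    using witt_decomp by metis
  also have "\<dots> = bracket witt x y"
    by (simp add: witt_def witt_deg_sum sum_product mult_single witt_deg_single flip: sum_subtractf)
       (simp add: algebra_simps flip: single_diff)
  finally show ?thesis by simp
qed

lemma smult_witt: "smult witt a x = Poly_Mapping.single 0 a * x"
  by (simp add: witt_def mult_map_scale_conv_mult)

lemma witt_deg_smult: "witt_deg (Poly_Mapping.single 0 a * x) = Poly_Mapping.single 0 a * witt_deg x"
  by (simp add: witt_deg_mult witt_deg_single)

lemma witt_bracket_closed:
  assumes "x \<in> carrier witt" "y \<in> carrier witt"
  shows "bracket witt x y \<in> carrier witt"
proof -
  have "Poly_Mapping.keys (bracket witt x y) \<subseteq> (\<Union>i\<in>Poly_Mapping.keys x. \<Union>j\<in>Poly_Mapping.keys y.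
     Poly_Mapping.keys (Poly_Mapping.single (i + j)
               (of_int (i - j) * Poly_Mapping.lookup x i * Poly_Mapping.lookup y j)))"
    unfolding witt_def lie_algebra.simps by (intro order.trans[OF keys_sum] UN_mono order.refl)
  also have "\<dots> \<subseteq> {-1..}"
  proof -
    have "i + j \<ge> -1" if "i \<noteq> j" "i \<ge> -1" "j \<ge> -1" for i j :: int using that by linarith
    then show ?thesis using assms by (fastforce simp: witt_def split: if_splits)
  qed
  finally show ?thesis by (simp add: witt_def)
qed

lemma witt_smult_closed:
  assumes "x \<in> carrier witt" shows "a \<odot>\<^bsub>witt\<^esub> x \<in> carrier witt"
proof -
  have "Poly_Mapping.keys (a \<odot>\<^bsub>witt\<^esub> x) \<subseteq> Poly_Mapping.keys x"
    by (auto simp: witt_def in_keys_iff Poly_Mapping.map.rep_eq)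
  then show ?thesis using assms by (auto simp: witt_def)
qed

lemma is_lie_algebra_witt: "is_lie_algebra witt"
proof -
  have ops: "add witt = (+)" "zero witt = 0" by (simp_all add: witt_def)
  have "abelian_group witt"
  proof (rule abelian_groupI, goal_cases)
    case (1 x y)
    then show ?case using Poly_Mapping.keys_add[of x y] by (auto simp: witt_def)
  next
    case (6 x)
    then show ?case by (intro bexI[of _ "- x"]) (auto simp: witt_def)
  qed (simp_all add: witt_def add_ac)
  then have "Module.module complex_field witt"
    by (intro Module.moduleI cring_from_type_algebra)
       (simp_all add: witt_smult_closed[unfolded smult_witt] smult_witt ops distrib_left distrib_right single_add
          mult_single flip: mult.assoc)
  then show ?thesis
    unfolding is_lie_algebra_def ops
    by (simp add: witt_bracket_closed)
       (simp add: witt_bracket_eq smult_witt witt_deg_add witt_deg_diff witt_deg_smult witt_deg_mult witt_deg_single algebra_simps)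
qed

lemma sl2_to_witt_hom: "is_lie_hom sl2 witt sl2_to_witt"
  unfolding is_lie_hom_def
proof (intro conjI ballI allI Pi_I)
  fix A :: "complex^2^2"
  show "sl2_to_witt A \<in> carrier witt"
    by (auto simp: sl2_to_witt_def witt_def keys_def lookup_add lookup_single when_def split: if_splits)
next
  fix A B :: "complex^2^2"
  show "sl2_to_witt (A \<oplus>\<^bsub>sl2\<^esub> B) = sl2_to_witt A \<oplus>\<^bsub>witt\<^esub> sl2_to_witt B"
    by (rule poly_mapping_eqI) (simp add: sl2_to_witt_def witt_def sl2_def lookup_add lookup_single when_def)
next
  fix A :: "complex^2^2" and a
  show "sl2_to_witt (a \<odot>\<^bsub>sl2\<^esub> A) = a \<odot>\<^bsub>witt\<^esub> sl2_to_witt A"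
    by (rule poly_mapping_eqI) (simp add: sl2_to_witt_def smult_witt sl2_def lookup_add lookup_single when_def mult_single algebra_simps)
next
  fix A B :: "complex^2^2" assume "A \<in> carrier sl2" "B \<in> carrier sl2"
  then have AB: "A $ 2 $ 2 = - (A $ 1 $ 1)" "B $ 2 $ 2 = - (B $ 1 $ 1)"
    by (auto simp: sl2_def trace_def sum_2 add_eq_0_iff)
  show "sl2_to_witt (bracket sl2 A B) = bracket witt (sl2_to_witt A) (sl2_to_witt B)"
    unfolding witt_bracket_eq
    by (rule poly_mapping_eqI) (simp add: sl2_to_witt_def sl2_def AB witt_deg_add witt_deg_single matrix_matrix_mult_def sum_2
      lookup_add lookup_minus lookup_single when_def mult_single algebra_simps)
qed

lemma sl2_to_witt_inj: "inj_on sl2_to_witt (carrier sl2)"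
proof (rule inj_onI)
  fix A B :: "complex^2^2" assume AB: "A \<in> carrier sl2" "B \<in> carrier sl2" "sl2_to_witt A = sl2_to_witt B"
  then have tr: "A $ 2 $ 2 = - (A $ 1 $ 1)" "B $ 2 $ 2 = - (B $ 1 $ 1)"
    by (auto simp: sl2_def trace_def sum_2 add_eq_0_iff)
  have "Poly_Mapping.lookup (sl2_to_witt A) k = Poly_Mapping.lookup (sl2_to_witt B) k" for k using AB by simp
  from this[of "-1"] this[of 0] this[of 1] show "A = B"
    by (simp add: sl2_to_witt_def lookup_add lookup_single when_def vec_eq_iff forall_2 tr)
qed

lemma is_functor_forget: "is_functor (lie_mod witt) (lie_mod sl2) forget_functor"
  unfolding forget_functor_def
  by (intro is_functor_restriction sl2_to_witt_hom is_lie_algebra_sl2)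


section \<open>The category $\bar{\mathfrak M}^{\xi,\tau}$\<close>

definition casimir :: "(complex^2^2, 'v) lie_rep \<Rightarrow> 'v \<Rightarrow> 'v" where
  "casimir M m =
     (let h1 = (\<lambda>v. act M sl2_h v \<oplus>\<^bsub>M\<^esub> v)
      in h1 (h1 m) \<oplus>\<^bsub>M\<^esub> 4 \<odot>\<^bsub>M\<^esub> act M sl2_f (act M sl2_e m))"

definition weight_space :: "(complex^2^2, 'v) lie_rep \<Rightarrow> complex \<Rightarrow> 'v set" where
  "weight_space M \<mu> = {m \<in> carrier M. act M sl2_h m = \<mu> \<odot>\<^bsub>M\<^esub> m}"

text \<open>$M = \bigoplus_\mu M_\mu$ as an internal direct sum.\<close>

definition weight_module :: "(complex^2^2, 'v) lie_rep \<Rightarrow> bool" where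
  "weight_module M \<longleftrightarrow>
     (\<forall>m\<in>carrier M. \<exists>!u. (\<forall>\<mu>. u \<mu> \<in> weight_space M \<mu>) \<and> finite {\<mu>. u \<mu> \<noteq> \<zero>\<^bsub>M\<^esub>} \<and>
        m = (\<Oplus>\<^bsub>M\<^esub>\<mu>\<in>{\<mu>. u \<mu> \<noteq> \<zero>\<^bsub>M\<^esub>}. u \<mu>))"

definition weight_supp :: "(complex^2^2, 'v) lie_rep \<Rightarrow> complex set" where
  "weight_supp M = {\<mu>. weight_space M \<mu> \<noteq> {\<zero>\<^bsub>M\<^esub>}}"

definition finite_dim_subspace :: "(complex^2^2, 'v) lie_rep \<Rightarrow> 'v set \<Rightarrow> bool" where
  "finite_dim_subspace M W \<longleftrightarrow>
     (\<exists>B. finite B \<and> B \<subseteq> W \<and> (\<forall>w\<in>W. \<exists>a. w = (\<Oplus>\<^bsub>M\<^esub>b\<in>B. a b \<odot>\<^bsub>M\<^esub> b)))"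

definition M_bar ::
  "complex set \<Rightarrow> complex \<Rightarrow> ((complex^2^2, 'v) lie_rep, 'v \<Rightarrow> 'v) category" where
  "M_bar \<xi> \<tau> = full_subcategory (lie_mod sl2)
     (\<lambda>M. weight_module M \<and>
          (\<forall>\<mu>. finite_dim_subspace M (weight_space M \<mu>)) \<and>
          weight_supp M \<subseteq> \<xi> \<and>
          (\<forall>\<mu>\<in>\<xi>. \<exists>n. \<forall>m\<in>weight_space M \<mu>.
             ((\<lambda>v. casimir M v \<ominus>\<^bsub>M\<^esub> \<tau> \<odot>\<^bsub>M\<^esub> v) ^^ n) m = \<zero>\<^bsub>M\<^esub>))"

text \<open>The quotient $\mathbb C/2\mathbb Z$, whose elements are cosets.\<close>

definition C_mod_2Z :: "complex set set" where
  "C_mod_2Z = UNIV // {(x, y). \<exists>k::int. x - y = 2 * of_int k}"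

end

theory Submission
  imports Defs "HOL-Computational_Algebra.Formal_Power_Series"
begin

text \<open>
  On the space of densities \<open>\<psi>(z) (dz)\<^sup>b\<close> the element \<open>L\<^sub>k\<close> of the Witt algebra acts by
  \<open>-z\<^sup>k\<^sup>+\<^sup>1 \<partial> - (k + 1) b z\<^sup>k\<close>. Restricted to \<open>sl(2)\<close>, this gives \<open>f = -\<partial>\<close>, \<open>h = 2(z\<partial> + b)\<close> and the Casimir
  operator \<open>c = (2b - 1)\<^sup>2\<close>. The formulas can be inverted: on an \<open>sl(2)\<close>-module on which \<open>f\<close> is bijective
  and \<open>c\<close> has a square root \<open>S\<close> that commutes with the action, put \<open>B = (1 + S)/2\<close> and
  \<open>Z = (B - h/2) f\<^sup>-\<^sup>1\<close>. Then \<open>[f, Z] = -1\<close>, the operator \<open>B\<close> commutes with \<open>f\<close> and \<open>Z\<close>, and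
  \<open>L\<^sub>k = Z\<^sup>k\<^sup>+\<^sup>1 f - (k + 1) Z\<^sup>k B\<close> satisfies the relations of the Witt algebra for \<open>k \<ge> -1\<close>
  (\<open>weyl_pair.density_op_commutator\<close>). Moreover \<open>L\<^sub>-\<^sub>1\<close>, \<open>-2L\<^sub>0\<close>, \<open>-L\<^sub>1\<close> are the given operators
  \<open>f\<close>, \<open>h\<close>, \<open>e\<close> (\<open>generic_block.L_sl2\<close>), so restriction to \<open>sl(2)\<close> returns the module unchanged.

  The hypotheses provide \<open>S\<close> and \<open>f\<^sup>-\<^sup>1\<close>. The operator \<open>c - \<tau>\<close> is nilpotent on each weight space, hence
  locally nilpotent, and power series in it make sense. As \<open>\<tau> \<noteq> 0\<close>, the series \<open>\<tau> + X\<close> has a square root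
  with constant term \<open>\<surd>\<tau>\<close>; this gives \<open>S\<close>. The operators \<open>4fe = c - (h + 1)\<^sup>2\<close> and
  \<open>4ef = c - (h - 1)\<^sup>2\<close> act on the weight space of \<open>\<mu>\<close> as \<open>\<tau> - (\<mu> + 1)\<^sup>2\<close> and \<open>\<tau> - (\<mu> - 1)\<^sup>2\<close> plus a
  nilpotent operator. Both numbers are nonzero since \<open>\<mu>\<close> and \<open>\<mu> - 2\<close> lie in \<open>\<xi>\<close>, so both operators are
  bijective, and therefore \<open>f\<close> is (\<open>generic_block.f_bij\<close>).

  The functor leaves the underlying maps of homomorphisms unchanged. It is full because the new operators
  are built from the \<open>sl(2)\<close>-action by inverses and power series, which every homomorphism respects
  (\<open>generic_block_hom.hom_witt_act\<close>).

  Identities between vectors of a module are tested on linear functionals, which separate points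
  (\<open>complex_space.functional_eqI\<close>), and so become identities between complex numbers.
\<close>

section \<open>Linear functionals on a complex vector space\<close>

lemma lookup_scale: "Poly_Mapping.lookup (Poly_Mapping.map ((*) a) p) k = a * Poly_Mapping.lookup p k"
  for a :: "'a :: mult_zero"
  by (simp add: Poly_Mapping.map.rep_eq when_def)

text \<open>
  The lemmas at the start of this locale restate the axioms of a module over \<^term>\<open>complex_field\<close>
  with the operations of the type \<^typ>\<open>complex\<close>, in which form the simplifier can use them.
\<close>

locale complex_space = Module.module complex_field M for M :: "(complex, 'v, 'z) module_scheme" (structure)
begin

lemma scale_closed [simp, intro]: "x \<in> carrier M \<Longrightarrow> a \<odot> x \<in> carrier M"
  using smult_closed[of a x] by simp

lemma scale_add_left: "x \<in> carrier M \<Longrightarrow> (a + b) \<odot> x = a \<odot> x \<oplus> b \<odot> x"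
  using smult_l_distr[of a b x] by simp

lemma scale_add_right: "x \<in> carrier M \<Longrightarrow> y \<in> carrier M \<Longrightarrow> a \<odot> (x \<oplus> y) = a \<odot> x \<oplus> a \<odot> y"
  using smult_r_distr[of a x y] by simp

lemma scale_scale: "x \<in> carrier M \<Longrightarrow> a \<odot> (b \<odot> x) = (a * b) \<odot> x"
  using smult_assoc1[of a b x] by simp

lemma scale_one [simp]: "x \<in> carrier M \<Longrightarrow> 1 \<odot> x = x"
  using smult_one[of x] by simp

lemma scale_zero_left [simp]: "x \<in> carrier M \<Longrightarrow> 0 \<odot> x = \<zero>"
  using smult_l_null[of x] by simp

lemma scale_zero_right [simp]: "a \<odot> \<zero> = \<zero>"
  using smult_r_null[of a] by simp

definition functional :: "('v \<Rightarrow> complex) \<Rightarrow> bool" where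
  "functional g \<longleftrightarrow> (\<forall>x\<in>carrier M. \<forall>y\<in>carrier M. g (x \<oplus> y) = g x + g y) \<and>
     (\<forall>a. \<forall>x\<in>carrier M. g (a \<odot> x) = a * g x)"

lemma functional_add: "functional g \<Longrightarrow> x \<in> carrier M \<Longrightarrow> y \<in> carrier M \<Longrightarrow> g (x \<oplus> y) = g x + g y"
  and functional_scale: "functional g \<Longrightarrow> x \<in> carrier M \<Longrightarrow> g (a \<odot> x) = a * g x"
  by (auto simp: functional_def)

lemma functional_zero: "functional g \<Longrightarrow> g \<zero> = 0"
  using functional_scale[of g \<zero> 0] by simp

lemma functional_diff:
  assumes "functional g" "x \<in> carrier M" "y \<in> carrier M"
  shows "g (x \<ominus> y) = g x - g y"
proof -
  have "g (y \<oplus> \<ominus> y) = g y + g (\<ominus> y)"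
    using assms by (intro functional_add) auto
  then have "g (\<ominus> y) = - g y"
    using assms by (simp add: r_neg functional_zero add_eq_0_iff)
  then show ?thesis
    using assms by (simp add: a_minus_def functional_add)
qed

lemma functional_finsum:
  assumes "functional g" "\<And>i. i \<in> A \<Longrightarrow> f i \<in> carrier M"
  shows "g (finsum M f A) = (\<Sum>i\<in>A. g (f i))"
  using assms(2)
proof (induction A rule: infinite_finite_induct)
  case (insert i A)
  then show ?case
    using assms(1) by (subst finsum_insert) (auto simp: functional_add)
qed (auto simp: functional_zero assms(1))

lemmas functional_simps = functional_add functional_scale functional_zero functional_diff

text \<open>
  The free vector space on the elements of the type \<^typ>\<open>'v\<close> maps onto \<^term>\<open>carrier M\<close> by
  evaluation of linear combinations. Being an additive group on a whole type, the free space is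
  within reach of the basis theorems for \<^locale>\<open>vector_space\<close>.
\<close>

definition eval_comb :: "('v \<Rightarrow>\<^sub>0 complex) \<Rightarrow> 'v" where
  "eval_comb p = (\<Oplus>v\<in>Poly_Mapping.keys p. Poly_Mapping.lookup p v \<odot> (if v \<in> carrier M then v else \<zero>))"

lemma eval_comb_superset:
  assumes "finite A" "Poly_Mapping.keys p \<subseteq> A"
  shows "eval_comb p = (\<Oplus>v\<in>A. Poly_Mapping.lookup p v \<odot> (if v \<in> carrier M then v else \<zero>))"
  unfolding eval_comb_def using assms
  by (intro add.finprod_mono_neutral_cong_left) (auto simp: in_keys_iff)

lemma eval_comb_closed: "eval_comb p \<in> carrier M"
  unfolding eval_comb_def by (intro finsum_closed) auto

lemma eval_comb_add: "eval_comb (p + q) = eval_comb p \<oplus> eval_comb q"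
proof -
  let ?A = "Poly_Mapping.keys p \<union> Poly_Mapping.keys q"
  have *: "eval_comb r = (\<Oplus>v\<in>?A. Poly_Mapping.lookup r v \<odot> (if v \<in> carrier M then v else \<zero>))"
    if "r \<in> {p, q, p + q}" for r
    using that Poly_Mapping.keys_add[of p q] by (intro eval_comb_superset) auto
  show ?thesis
    by (simp add: * lookup_add scale_add_left flip: finsum_addf)
qed

lemma eval_comb_scale: "eval_comb (Poly_Mapping.map ((*) a) p) = a \<odot> eval_comb p"
proof -
  have "eval_comb (Poly_Mapping.map ((*) a) p) = (\<Oplus>v\<in>Poly_Mapping.keys p.
      Poly_Mapping.lookup (Poly_Mapping.map ((*) a) p) v \<odot> (if v \<in> carrier M then v else \<zero>))"
    by (intro eval_comb_superset) (auto simp: in_keys_iff lookup_scale)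
  also have "\<dots> = (\<Oplus>v\<in>Poly_Mapping.keys p. a \<odot> (Poly_Mapping.lookup p v \<odot> (if v \<in> carrier M then v else \<zero>)))"
    by (intro finsum_cong') (auto simp: scale_scale lookup_scale)
  also have "\<dots> = a \<odot> eval_comb p"
    unfolding eval_comb_def by (subst finsum_smult_ldistr) auto
  finally show ?thesis .
qed

lemma eval_comb_single: "x \<in> carrier M \<Longrightarrow> eval_comb (Poly_Mapping.single x a) = a \<odot> x"
  by (subst eval_comb_superset[of "{x}"]) (auto simp: finsum_insert)

lemma eval_comb_diff: "eval_comb (p - q) = eval_comb p \<oplus> (-1) \<odot> eval_comb q"
proof -
  have "p - q = p + Poly_Mapping.map ((*) (-1)) q"
    by (rule poly_mapping_eqI) (simp add: lookup_add lookup_minus lookup_scale)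
  then show ?thesis
    by (simp only: eval_comb_add eval_comb_scale)
qed

lemma scale_minus_cancel: "x \<in> carrier M \<Longrightarrow> x \<oplus> (-1) \<odot> x = \<zero>"
  using scale_add_left[of x 1 "-1"] by simp

text \<open>
  In the free vector space the generator of a vector \<open>z \<noteq> \<zero>\<close> lies outside the kernel of evaluation.
  A basis of the kernel can be enlarged by this generator, so some functional on the free space
  kills the kernel and is \<open>1\<close> on the generator; it descends to the vector space itself.
\<close>

lemma separating_functional:
  assumes z: "z \<in> carrier M" "z \<noteq> \<zero>"
  obtains g where "functional g" "g z = 1"
proof -
  let ?sc = "\<lambda>a. Poly_Mapping.map ((*) a) :: ('v \<Rightarrow>\<^sub>0 complex) \<Rightarrow> _"
  interpret vector_space_pair ?sc "(*) :: complex \<Rightarrow> complex \<Rightarrow> complex"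
    by unfold_locales (auto intro!: poly_mapping_eqI simp: lookup_scale lookup_add algebra_simps)
  let ?K = "{p. eval_comb p = \<zero>}"
  have K: "vs1.subspace ?K"
    unfolding vs1.subspace_def
    using eval_comb_scale[of 0 0] by (auto simp: eval_comb_add eval_comb_scale eval_comb_closed)
  obtain B where B: "B \<subseteq> ?K" "vs1.independent B" "?K \<subseteq> vs1.span B"
    using vs1.maximal_independent_subset[of ?K] by blast
  have span: "vs1.span B = ?K"
    using B K vs1.span_minimal by blast
  let ?w = "Poly_Mapping.single z 1 :: 'v \<Rightarrow>\<^sub>0 complex"
  have w: "?w \<notin> vs1.span B"
    using z by (simp add: span eval_comb_single)
  obtain g where g: "Vector_Spaces.linear ?sc (*) g" "\<forall>x\<in>insert ?w B. g x = (if x = ?w then 1 else 0)"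
    using linear_independent_extend[OF vs1.independent_insertI[OF w B(2)], of "\<lambda>x. if x = ?w then 1 else 0"]
    by blast
  interpret g: Vector_Spaces.linear ?sc "(*)" g by (fact g)
  have "g x = 0" if "x \<in> B" for x
  proof -
    have "x \<noteq> ?w" using that w vs1.span_base[of x B] by blast
    then show ?thesis using g(2) that by simp
  qed
  then have K0: "g p = 0" if "eval_comb p = \<zero>" for p
    using linear_eq_0_on_span[OF g(1), of B p] that unfolding span by blast
  have K0': "g p = g q" if "eval_comb p = eval_comb q" for p q
  proof -
    have "eval_comb (p - q) = \<zero>"
      by (simp add: eval_comb_diff that scale_minus_cancel eval_comb_closed)
    then show ?thesis using K0[of "p - q"] g.diff[of p q] by simp
  qed
  have "functional (\<lambda>v. g (Poly_Mapping.single v 1))"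
    unfolding functional_def
  proof (intro conjI ballI allI)
    fix x y assume xy: "x \<in> carrier M" "y \<in> carrier M"
    then have "g (Poly_Mapping.single (x \<oplus> y) 1) = g (Poly_Mapping.single x 1 + Poly_Mapping.single y 1)"
      by (intro K0') (simp add: eval_comb_single eval_comb_add)
    then show "g (Poly_Mapping.single (x \<oplus> y) 1) = g (Poly_Mapping.single x 1) + g (Poly_Mapping.single y 1)"
      by (simp add: g.add)
  next
    fix a x assume x: "x \<in> carrier M"
    then have "g (Poly_Mapping.single (a \<odot> x) 1) = g (?sc a (Poly_Mapping.single x 1))"
      by (intro K0') (simp add: eval_comb_single eval_comb_scale)
    then show "g (Poly_Mapping.single (a \<odot> x) 1) = a * g (Poly_Mapping.single x 1)"
      by (simp only: g.scale)
  qed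
  moreover have "g ?w = 1" using g(2) by simp
  ultimately show ?thesis using that[of "\<lambda>v. g (Poly_Mapping.single v 1)"] by blast
qed

lemma diff_eq_zero_iff: "x \<in> carrier M \<Longrightarrow> y \<in> carrier M \<Longrightarrow> x \<ominus> y = \<zero> \<longleftrightarrow> x = y"
  using minus_equality[of x "\<ominus> y"] by (auto simp: a_minus_def r_neg)

text \<open>
  This rule turns a linear identity between vectors into an identity between complex numbers, which
  the simplifier can normalise. Almost all identities below are proved in this way.
\<close>

lemma functional_eqI:
  assumes "x \<in> carrier M" "y \<in> carrier M" "\<And>g. functional g \<Longrightarrow> g x = g y"
  shows "x = y"
proof (rule ccontr)
  assume "x \<noteq> y"
  then obtain g where "functional g" "g (x \<ominus> y) = 1"
    using separating_functional[of "x \<ominus> y"] assms(1,2) diff_eq_zero_iff by auto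
  then show False
    using assms(3)[of g] functional_diff[of g x y] assms(1,2) by simp
qed

end

definition linear_map :: "(complex, 'v, 'z) module_scheme \<Rightarrow> (complex, 'w, 'y) module_scheme \<Rightarrow> ('v \<Rightarrow> 'w) \<Rightarrow> bool" where
  "linear_map M N T \<longleftrightarrow> T \<in> carrier M \<rightarrow> carrier N \<and>
     (\<forall>x\<in>carrier M. \<forall>y\<in>carrier M. T (x \<oplus>\<^bsub>M\<^esub> y) = T x \<oplus>\<^bsub>N\<^esub> T y) \<and>
     (\<forall>a. \<forall>x\<in>carrier M. T (a \<odot>\<^bsub>M\<^esub> x) = a \<odot>\<^bsub>N\<^esub> T x)"

lemma linear_map_closed: "linear_map M N T \<Longrightarrow> x \<in> carrier M \<Longrightarrow> T x \<in> carrier N"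
  and linear_map_add: "linear_map M N T \<Longrightarrow> x \<in> carrier M \<Longrightarrow> y \<in> carrier M \<Longrightarrow> T (x \<oplus>\<^bsub>M\<^esub> y) = T x \<oplus>\<^bsub>N\<^esub> T y"
  and linear_map_scale: "linear_map M N T \<Longrightarrow> x \<in> carrier M \<Longrightarrow> T (a \<odot>\<^bsub>M\<^esub> x) = a \<odot>\<^bsub>N\<^esub> T x"
  by (auto simp: linear_map_def)

lemma linear_map_functional:
  assumes "complex_space M" "complex_space N" "linear_map M N T" "complex_space.functional N g"
  shows "complex_space.functional M (\<lambda>x. g (T x))"
proof -
  interpret M: complex_space M by fact
  interpret N: complex_space N by fact
  show ?thesis using assms(3,4)
    by (auto simp: M.functional_def N.functional_def linear_map_def Pi_iff)
qed

lemma linear_map_diff: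
  assumes "complex_space M" "complex_space N" "linear_map M N T" "x \<in> carrier M" "y \<in> carrier M"
  shows "T (x \<ominus>\<^bsub>M\<^esub> y) = T x \<ominus>\<^bsub>N\<^esub> T y"
proof -
  interpret M: complex_space M by fact
  interpret N: complex_space N by fact
  show ?thesis
  proof (rule N.functional_eqI)
    fix g assume g: "N.functional g"
    note gT = linear_map_functional[OF assms(1-3) g]
    show "g (T (x \<ominus>\<^bsub>M\<^esub> y)) = g (T x \<ominus>\<^bsub>N\<^esub> T y)"
      using M.functional_diff[OF gT assms(4,5)] assms N.functional_diff[OF g]
      by (simp add: linear_map_closed)
  qed (use assms in \<open>auto simp: linear_map_closed\<close>)
qed

lemma linear_map_zero:
  assumes "complex_space M" "complex_space N" "linear_map M N T"
  shows "T \<zero>\<^bsub>M\<^esub> = \<zero>\<^bsub>N\<^esub>"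
proof -
  interpret M: complex_space M by fact
  interpret N: complex_space N by fact
  show ?thesis using linear_map_scale[OF assms(3), of "\<zero>\<^bsub>M\<^esub>" 0] assms(3)
    by (simp add: linear_map_closed)
qed

section \<open>Power series in a locally nilpotent operator\<close>

lemma linear_map_funpow:
  assumes "linear_map M M T"
  shows "linear_map M M (T ^^ n)"
proof (induction n)
  case 0
  show ?case by (simp add: linear_map_def)
next
  case (Suc n)
  then show ?case using assms by (auto simp: linear_map_def Pi_iff)
qed

lemma funpow_intertwine:
  assumes "\<And>m. m \<in> carrier M \<Longrightarrow> \<phi> (T m) = T' (\<phi> m)" "linear_map M M T" "m \<in> carrier M"
  shows "\<phi> ((T ^^ n) m) = (T' ^^ n) (\<phi> m)"
proof (induction n)
  case (Suc n)
  have "(T ^^ n) m \<in> carrier M"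
    using linear_map_closed[OF linear_map_funpow[OF assms(2)] assms(3)] .
  then show ?case using Suc assms(1) by simp
qed simp

text \<open>
  The series \<open>\<Sum>k. F\<^sub>k T\<^sup>k m\<close> for a locally nilpotent \<open>T\<close>. The truncation point depends on \<open>m\<close>, but by
  \<open>functional_fps_op\<close> below any later one gives the same value; that is what makes
  \<open>m \<mapsto> F(T) m\<close> linear.
\<close>

definition fps_op :: "(complex, 'v, 'z) module_scheme \<Rightarrow> complex fps \<Rightarrow> ('v \<Rightarrow> 'v) \<Rightarrow> 'v \<Rightarrow> 'v" where
  "fps_op M F T m = (\<Oplus>\<^bsub>M\<^esub>k\<in>{..<LEAST n. (T ^^ n) m = \<zero>\<^bsub>M\<^esub>}. fps_nth F k \<odot>\<^bsub>M\<^esub> (T ^^ k) m)"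

locale locally_nilpotent = complex_space M for M :: "(complex, 'v, 'z) module_scheme" (structure) +
  fixes T :: "'v \<Rightarrow> 'v"
  assumes lin: "linear_map M M T"
    and nil: "m \<in> carrier M \<Longrightarrow> \<exists>n. (T ^^ n) m = \<zero>"
begin

lemma complex_space: "complex_space M" ..

lemmas funpow_linear = linear_map_funpow[OF lin]

lemma funpow_closed [simp]: "m \<in> carrier M \<Longrightarrow> (T ^^ k) m \<in> carrier M"
  by (rule linear_map_closed[OF funpow_linear])

lemma funpow_zero: "(T ^^ k) \<zero> = \<zero>"
  by (rule linear_map_zero[OF complex_space complex_space funpow_linear])

lemma funpow_eq_zero_mono:
  assumes "(T ^^ n) m = \<zero>" "n \<le> k"
  shows "(T ^^ k) m = \<zero>"
proof -
  have "(T ^^ k) m = (T ^^ (k - n)) ((T ^^ n) m)"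
    using funpow_add[of "k - n" n T] assms(2) by simp
  then show ?thesis by (simp add: assms(1) funpow_zero)
qed

lemma fps_op_closed [simp]: "m \<in> carrier M \<Longrightarrow> fps_op M F T m \<in> carrier M"
  unfolding fps_op_def by (intro finsum_closed) auto

lemma functional_fps_op:
  assumes "functional g" "m \<in> carrier M" "(T ^^ n) m = \<zero>"
  shows "g (fps_op M F T m) = (\<Sum>k<n. fps_nth F k * g ((T ^^ k) m))"
proof -
  let ?l = "LEAST n. (T ^^ n) m = \<zero>"
  have "g (fps_op M F T m) = (\<Sum>k<?l. fps_nth F k * g ((T ^^ k) m))"
    unfolding fps_op_def using assms by (simp add: functional_finsum functional_simps)
  also have "\<dots> = (\<Sum>k<n. fps_nth F k * g ((T ^^ k) m))"
  proof (rule sum.mono_neutral_left)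
    show "{..<?l} \<subseteq> {..<n}"
      using Least_le[of "\<lambda>n. (T ^^ n) m = \<zero>" n] assms(3) by auto
    show "\<forall>k\<in>{..<n} - {..<?l}. fps_nth F k * g ((T ^^ k) m) = 0"
      using funpow_eq_zero_mono[OF LeastI[of "\<lambda>n. (T ^^ n) m = \<zero>", OF assms(3)]] assms(1)
      by (auto simp: functional_zero)
  qed simp
  finally show ?thesis .
qed

text \<open>
  A linear map that intertwines two operators intertwines all power series in them. With \<open>\<phi>\<close> an
  operator on \<^term>\<open>M\<close>, this says that whatever commutes with \<open>T\<close> commutes with \<open>F(T)\<close>; with \<open>\<phi>\<close> a
  homomorphism of modules, it makes \<open>F(T)\<close> natural.
\<close>

lemma fps_op_natural:
  assumes N: "locally_nilpotent N T'" and \<phi>: "linear_map M N \<phi>"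
    and comm: "\<And>m. m \<in> carrier M \<Longrightarrow> \<phi> (T m) = T' (\<phi> m)" and m: "m \<in> carrier M"
  shows "\<phi> (fps_op M F T m) = fps_op N F T' (\<phi> m)"
proof -
  interpret N: locally_nilpotent N T' by fact
  obtain n where n: "(T ^^ n) m = \<zero>" using nil m by blast
  have pow: "\<phi> ((T ^^ k) m) = (T' ^^ k) (\<phi> m)" for k
    by (rule funpow_intertwine[where \<phi> = \<phi> and T = T, OF comm lin m])
  have n': "(T' ^^ n) (\<phi> m) = \<zero>\<^bsub>N\<^esub>"
    using pow[of n] n linear_map_zero[OF complex_space N.complex_space \<phi>] by simp
  have \<phi>m: "\<phi> m \<in> carrier N" using linear_map_closed[OF \<phi> m] .
  show ?thesis
  proof (rule N.functional_eqI)
    fix g assume g: "N.functional g"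
    note g\<phi> = linear_map_functional[OF complex_space N.complex_space \<phi> g]
    show "g (\<phi> (fps_op M F T m)) = g (fps_op N F T' (\<phi> m))"
      using functional_fps_op[OF g\<phi> m n] N.functional_fps_op[OF g \<phi>m n'] by (simp add: pow)
  qed (use m \<phi>m linear_map_closed[OF \<phi>] in auto)
qed

lemma fps_op_linear: "linear_map M M (fps_op M F T)"
  unfolding linear_map_def
proof (intro conjI ballI allI)
  fix x y assume xy: "x \<in> carrier M" "y \<in> carrier M"
  obtain i j where ij: "(T ^^ i) x = \<zero>" "(T ^^ j) y = \<zero>" using nil xy by metis
  define n where "n = max i j"
  have n: "(T ^^ n) x = \<zero>" "(T ^^ n) y = \<zero>"
    using ij funpow_eq_zero_mono unfolding n_def by (meson max.cobounded1 max.cobounded2)+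
  have n': "(T ^^ n) (x \<oplus> y) = \<zero>"
    using xy n by (simp add: linear_map_add[OF funpow_linear])
  show "fps_op M F T (x \<oplus> y) = fps_op M F T x \<oplus> fps_op M F T y"
    by (rule functional_eqI)
       (use xy n in \<open>auto simp: functional_simps functional_fps_op[OF _ _ n'] functional_fps_op
          linear_map_add[OF funpow_linear] algebra_simps sum.distrib\<close>)
next
  fix a x assume x: "x \<in> carrier M"
  obtain n where n: "(T ^^ n) x = \<zero>" using nil x by metis
  have n': "(T ^^ n) (a \<odot> x) = \<zero>"
    using x n by (simp add: linear_map_scale[OF funpow_linear])
  show "fps_op M F T (a \<odot> x) = a \<odot> fps_op M F T x"
    by (rule functional_eqI)
       (use x n in \<open>auto simp: functional_simps functional_fps_op[OF _ _ n'] functional_fps_op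
          linear_map_scale[OF funpow_linear] algebra_simps sum_distrib_left\<close>)
qed auto

lemma fps_op_add:
  assumes m: "m \<in> carrier M"
  shows "fps_op M (F + G) T m = fps_op M F T m \<oplus> fps_op M G T m"
proof -
  obtain n where n: "(T ^^ n) m = \<zero>" using nil m by metis
  show ?thesis
    by (rule functional_eqI)
       (use m n in \<open>auto simp: functional_simps functional_fps_op algebra_simps sum.distrib\<close>)
qed

lemma fps_op_const:
  assumes m: "m \<in> carrier M"
  shows "fps_op M (fps_const a) T m = a \<odot> m"
proof -
  obtain n where n: "(T ^^ n) m = \<zero>" using nil m by metis
  have n: "(T ^^ Suc n) m = \<zero>" using funpow_eq_zero_mono[OF n, of "Suc n"] by simp
  show ?thesis
  proof (rule functional_eqI)
    fix g assume g: "functional g"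
    show "g (fps_op M (fps_const a) T m) = g (a \<odot> m)"
      unfolding functional_fps_op[OF g m n] using g m
      by (subst sum.lessThan_Suc_shift) (auto simp: functional_scale)
  qed (use m in auto)
qed

lemma fps_op_X:
  assumes m: "m \<in> carrier M"
  shows "fps_op M fps_X T m = T m"
proof -
  obtain n where n: "(T ^^ n) m = \<zero>" using nil m by metis
  have n: "(T ^^ Suc (Suc n)) m = \<zero>" using funpow_eq_zero_mono[OF n, of "Suc (Suc n)"] by simp
  show ?thesis
  proof (rule functional_eqI)
    fix g assume g: "functional g"
    have "g (fps_op M fps_X T m) = fps_nth fps_X 0 * g ((T ^^ 0) m) +
       (fps_nth fps_X 1 * g ((T ^^ 1) m) + (\<Sum>k<n. fps_nth fps_X (Suc (Suc k)) * g ((T ^^ (Suc (Suc k))) m)))"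
      unfolding functional_fps_op[OF g m n] by (simp only: sum.lessThan_Suc_shift One_nat_def)
    then show "g (fps_op M fps_X T m) = g (T m)"
      by simp
  qed (use m linear_map_closed[OF lin] in auto)
qed

text \<open>
  Both sides are sums over pairs \<open>(i, j)\<close> of the same terms: on the left over the triangle
  \<open>i + j < n\<close>, on the right over the square \<open>i, j < n\<close>. The terms outside the triangle contain
  \<open>T\<^sup>i\<^sup>+\<^sup>j m = \<zero>\<close>.
\<close>

lemma fps_op_mult:
  assumes m: "m \<in> carrier M"
  shows "fps_op M (F * G) T m = fps_op M F T (fps_op M G T m)"
proof -
  obtain n where n: "(T ^^ n) m = \<zero>" using nil m by metis
  have self: "locally_nilpotent M T" ..
  have comm: "(T ^^ k) (fps_op M G T m) = fps_op M G T ((T ^^ k) m)" for k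
    by (rule fps_op_natural[OF self funpow_linear _ m]) (simp add: funpow_swap1)
  have n': "(T ^^ n) (fps_op M G T m) = \<zero>"
    by (simp add: comm n linear_map_zero[OF complex_space complex_space fps_op_linear])
  show ?thesis
  proof (rule functional_eqI)
    fix g assume g: "functional g"
    have low: "k < n" if "g ((T ^^ k) m) \<noteq> 0" for k
      using that funpow_eq_zero_mono[OF n, of k] by (cases "k < n") (auto simp: functional_zero[OF g])
    define c where "c = (\<lambda>i j. fps_nth F i * (fps_nth G j * g ((T ^^ (i + j)) m)))"
    have "g (fps_op M F T (fps_op M G T m)) = (\<Sum>i<n. \<Sum>j<n. c i j)"
      unfolding functional_fps_op[OF g fps_op_closed[OF m] n'] c_def
    proof (intro sum.cong refl, goal_cases)
      case (1 i)
      have "(T ^^ n) ((T ^^ i) m) = \<zero>"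
        using funpow_eq_zero_mono[OF n, of "n + i"] by (simp add: funpow_add)
      then show ?case
        unfolding comm using functional_fps_op[OF g funpow_closed[OF m]]
        by (simp add: sum_distrib_left add.commute[of i] funpow_add)
    qed
    also have "\<dots> = (\<Sum>(i,j)\<in>{..<n} \<times> {..<n}. c i j)"
      by (simp add: sum.cartesian_product)
    also have "\<dots> = (\<Sum>(i,j)\<in>{(i,j). i + j < n}. c i j)"
      by (rule sum.mono_neutral_right)
         (use low in \<open>auto simp: c_def\<close>)
    also have "\<dots> = (\<Sum>k<n. \<Sum>i\<le>k. c i (k - i))"
      by (rule sum.triangle_reindex)
    also have "\<dots> = g (fps_op M (F * G) T m)"
      unfolding functional_fps_op[OF g m n]
      by (intro sum.cong refl) (simp add: c_def fps_mult_nth sum_distrib_right atLeast0AtMost mult.assoc)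
    finally show "g (fps_op M (F * G) T m) = g (fps_op M F T (fps_op M G T m))" by simp
  qed (use m in auto)
qed

text \<open>
  The series \<open>\<delta> + X\<close> is a unit because its constant term is not zero.
\<close>

lemma ex_inverse_shift:
  assumes "\<delta> \<noteq> 0"
  obtains G where "\<And>m. m \<in> carrier M \<Longrightarrow> fps_op M G T (\<delta> \<odot> m \<oplus> T m) = m"
    and "\<And>m. m \<in> carrier M \<Longrightarrow> \<delta> \<odot> fps_op M G T m \<oplus> T (fps_op M G T m) = m"
proof
  let ?F = "fps_const \<delta> + fps_X"
  have F: "fps_op M ?F T m = \<delta> \<odot> m \<oplus> T m" if "m \<in> carrier M" for m
    using that by (simp add: fps_op_add fps_op_const fps_op_X)
  have GF: "inverse ?F * ?F = fps_const 1"
    using assms by (simp add: inverse_mult_eq_1)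
  show "fps_op M (inverse ?F) T (\<delta> \<odot> m \<oplus> T m) = m" if "m \<in> carrier M" for m
    using that fps_op_mult[of m "inverse ?F" ?F] by (simp add: F GF fps_op_const del: fps_const_1_eq_1)
  show "\<delta> \<odot> fps_op M (inverse ?F) T m \<oplus> T (fps_op M (inverse ?F) T m) = m" if "m \<in> carrier M" for m
    using that fps_op_mult[of m ?F "inverse ?F"] GF
    by (simp add: F fps_op_const mult.commute[of ?F] del: fps_const_1_eq_1)
qed

text \<open>
  The series \<open>\<tau> + X\<close> has a square root because \<open>\<tau> \<noteq> 0\<close>; the choice of \<open>s\<close> fixes its constant term.
\<close>

lemma fps_op_square_root:
  assumes "s\<^sup>2 = \<tau>" "\<tau> \<noteq> 0" "m \<in> carrier M"
  defines "F \<equiv> fps_radical (\<lambda>_ _. s) 2 (fps_const \<tau> + fps_X)"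
  shows "fps_op M F T (fps_op M F T m) = \<tau> \<odot> m \<oplus> T m"
proof -
  have "F ^ 2 = fps_const \<tau> + fps_X"
    using power_radical[of "fps_const \<tau> + fps_X" "\<lambda>_ _. s" 1] assms(1,2)
    by (simp add: F_def numeral_2_eq_2)
  then show ?thesis
    using assms(3) fps_op_mult[of m F F]
    by (simp add: power2_eq_square fps_op_add fps_op_const fps_op_X)
qed

end

section \<open>Densities: from the Weyl algebra to the Witt algebra\<close>

lemma complex_space_cong:
  assumes "complex_space M" "carrier N = carrier M" "zero N = zero M" "add N = add M" "smult N = smult M"
  shows "complex_space N"
proof -
  interpret M: complex_space M by fact
  have "abelian_group N"
  proof (rule abelian_groupI, goal_cases)
    case (6 x)
    then show ?case
      using assms by (intro bexI[of _ "\<ominus>\<^bsub>M\<^esub> x"]) (auto simp: M.l_neg)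
  qed (auto simp: assms M.a_ac)
  then have "Module.module complex_field N"
    by (intro Module.moduleI cring_from_type_algebra)
       (use M.scale_add_left M.scale_add_right M.scale_scale[symmetric] in \<open>auto simp: assms\<close>)
  then show ?thesis by (simp add: complex_space_def)
qed

text \<open>
  On densities \<open>\<psi>(z) (dz)\<^sup>b\<close> the vector field \<open>-z\<^sup>k\<^sup>+\<^sup>1 \<partial>\<close> acts by \<open>-z\<^sup>k\<^sup>+\<^sup>1 \<partial> - (k + 1) b z\<^sup>k\<close>. Here \<open>n\<close> stands for
  \<open>k + 1\<close>, \<open>D\<close> for \<open>-\<partial>\<close>, and the number \<open>b\<close> is replaced by an operator \<open>B\<close>. For \<open>n = 0\<close> the second
  summand vanishes because of its coefficient, so the truncated exponent \<open>n - 1\<close> is harmless.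
\<close>

definition density_op :: "(complex, 'v, 'z) module_scheme \<Rightarrow> ('v \<Rightarrow> 'v) \<Rightarrow> ('v \<Rightarrow> 'v) \<Rightarrow> ('v \<Rightarrow> 'v) \<Rightarrow> nat \<Rightarrow> 'v \<Rightarrow> 'v" where
  "density_op M Z D B n m = (Z ^^ n) (D m) \<ominus>\<^bsub>M\<^esub> of_nat n \<odot>\<^bsub>M\<^esub> (Z ^^ (n - 1)) (B m)"

text \<open>
  With \<open>D = -\<partial>\<close> the relation \<open>[\<partial>, z] = 1\<close> reads \<open>DZ = ZD - 1\<close>.
\<close>

locale weyl_pair = complex_space M for M :: "(complex, 'v, 'z) module_scheme" (structure) +
  fixes Z D B :: "'v \<Rightarrow> 'v"
  assumes Z: "linear_map M M Z" and D: "linear_map M M D" and B: "linear_map M M B"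
    and DZ: "m \<in> carrier M \<Longrightarrow> D (Z m) = Z (D m) \<ominus> m"
    and BZ: "m \<in> carrier M \<Longrightarrow> B (Z m) = Z (B m)"
    and BD: "m \<in> carrier M \<Longrightarrow> B (D m) = D (B m)"
begin

lemma complex_space: "complex_space M" ..

lemmas closed [simp] = linear_map_closed[OF Z] linear_map_closed[OF D] linear_map_closed[OF B]
  linear_map_closed[OF linear_map_funpow[OF Z]]

lemmas linear_op_diff = linear_map_diff[OF complex_space complex_space]

lemmas linear_simps =
  linear_map_scale[OF Z] linear_map_scale[OF D] linear_map_scale[OF B] linear_map_scale[OF linear_map_funpow[OF Z]]
  linear_op_diff[OF Z] linear_op_diff[OF D] linear_op_diff[OF B] linear_op_diff[OF linear_map_funpow[OF Z]]

lemma D_Z_funpow: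
  assumes m: "m \<in> carrier M"
  shows "D ((Z ^^ n) m) = (Z ^^ n) (D m) \<ominus> of_nat n \<odot> (Z ^^ (n - 1)) m"
proof (induction n)
  case 0
  show ?case by (rule functional_eqI) (use m in \<open>auto simp: functional_simps\<close>)
next
  case (Suc n)
  show ?case
    by (cases n; rule functional_eqI)
       (use m Suc in \<open>auto simp: functional_simps DZ linear_simps algebra_simps\<close>)
qed

lemma B_Z_funpow: "m \<in> carrier M \<Longrightarrow> B ((Z ^^ n) m) = (Z ^^ n) (B m)"
  by (induction n) (auto simp: BZ)

text \<open>
  The product of two density operators in normal order, that is with all \<open>Z\<close> to the left. The first,
  the third and the last term are symmetric in \<open>i\<close> and \<open>j\<close>, hence cancel in the commutator.
\<close>

lemma functional_density_op_density_op:
  assumes m: "m \<in> carrier M" and g: "functional g"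
  shows "g (density_op M Z D B i (density_op M Z D B j m)) =
     g ((Z ^^ (i + j)) (D (D m))) - of_nat j * g ((Z ^^ (i + j - 1)) (D m))
     - of_nat (i + j) * g ((Z ^^ (i + j - 1)) (D (B m)))
     + of_nat (j * (j - 1)) * g ((Z ^^ (i + j - 2)) (B m))
     + of_nat (i * j) * g ((Z ^^ (i + j - 2)) (B (B m)))"
proof -
  have pow: "(Z ^^ a) ((Z ^^ b) x) = (Z ^^ (a + b)) x" for a b x
    by (simp add: funpow_add)
  have "g (density_op M Z D B i (density_op M Z D B j m)) =
     g ((Z ^^ (i + j)) (D (D m))) - of_nat j * g ((Z ^^ (i + (j - 1))) (D m))
     - of_nat j * g ((Z ^^ (i + (j - 1))) (D (B m)))
     + of_nat j * of_nat (j - 1) * g ((Z ^^ (i + (j - 1 - 1))) (B m))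
     - of_nat i * g ((Z ^^ (i - 1 + j)) (D (B m)))
     + of_nat i * of_nat j * g ((Z ^^ (i - 1 + (j - 1))) (B (B m)))"
    using m g by (simp add: density_op_def linear_simps D_Z_funpow B_Z_funpow BD functional_simps pow algebra_simps)
  (* Wherever a truncated subtraction of exponents goes wrong, the coefficient is zero. *)
  also have "i = 0 \<or> i \<ge> 1" "j = 0 \<or> j = 1 \<or> j \<ge> 2" by linarith+
  then have "g ((Z ^^ (i + j)) (D (D m))) - of_nat j * g ((Z ^^ (i + (j - 1))) (D m))
     - of_nat j * g ((Z ^^ (i + (j - 1))) (D (B m)))
     + of_nat j * of_nat (j - 1) * g ((Z ^^ (i + (j - 1 - 1))) (B m))
     - of_nat i * g ((Z ^^ (i - 1 + j)) (D (B m)))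
     + of_nat i * of_nat j * g ((Z ^^ (i - 1 + (j - 1))) (B (B m))) = 
     g ((Z ^^ (i + j)) (D (D m))) - of_nat j * g ((Z ^^ (i + j - 1)) (D m))
     - of_nat (i + j) * g ((Z ^^ (i + j - 1)) (D (B m)))
     + of_nat (j * (j - 1)) * g ((Z ^^ (i + j - 2)) (B m))
     + of_nat (i * j) * g ((Z ^^ (i + j - 2)) (B (B m)))"
    by (elim disjE) (simp_all add: algebra_simps numeral_2_eq_2)
  finally show ?thesis .
qed

lemma density_op_linear: "linear_map M M (density_op M Z D B n)"
  unfolding linear_map_def
proof (intro conjI ballI allI)
  fix x y assume xy: "x \<in> carrier M" "y \<in> carrier M"
  show "density_op M Z D B n (x \<oplus> y) = density_op M Z D B n x \<oplus> density_op M Z D B n y"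
    by (rule functional_eqI)
       (use xy in \<open>auto simp: density_op_def functional_simps linear_map_add[OF D] linear_map_add[OF B]
          linear_map_add[OF linear_map_funpow[OF Z]] algebra_simps\<close>)
next
  fix a x assume x: "x \<in> carrier M"
  show "density_op M Z D B n (a \<odot> x) = a \<odot> density_op M Z D B n x"
    by (rule functional_eqI)
       (use x in \<open>auto simp: density_op_def functional_simps linear_simps algebra_simps\<close>)
qed (auto simp: density_op_def)

text \<open>
  In terms of \<open>k = i - 1\<close> and \<open>l = j - 1\<close> this is \<open>[L\<^sub>k, L\<^sub>l] = (k - l) L\<^sub>k\<^sub>+\<^sub>l\<close>. For \<open>i = j = 0\<close> the index on the
  right is truncated, but its coefficient is zero.
\<close>

lemma density_op_commutator:
  assumes m: "m \<in> carrier M"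
  shows "density_op M Z D B i (density_op M Z D B j m) \<ominus> density_op M Z D B j (density_op M Z D B i m)
     = (of_nat i - of_nat j) \<odot> density_op M Z D B (i + j - 1) m"
proof (rule functional_eqI)
  fix g assume g: "functional g"
  have nat: "of_nat (j * (j - 1)) - of_nat (i * (i - 1)) = (of_nat j - of_nat i) * (of_nat (i + j - 1) :: complex)"
    by (cases i; cases j) (auto simp: algebra_simps)
  have "g (density_op M Z D B i (density_op M Z D B j m)) - g (density_op M Z D B j (density_op M Z D B i m))
      = (of_nat i - of_nat j) * g ((Z ^^ (i + j - 1)) (D m))
        + (of_nat (j * (j - 1)) - of_nat (i * (i - 1))) * g ((Z ^^ (i + j - 2)) (B m))"
    unfolding functional_density_op_density_op[OF m g] add.commute[of j i] mult.commute[of j i]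
    by (simp add: algebra_simps)
  then show "g (density_op M Z D B i (density_op M Z D B j m) \<ominus> density_op M Z D B j (density_op M Z D B i m))
     = g ((of_nat i - of_nat j) \<odot> density_op M Z D B (i + j - 1) m)"
    using m g linear_map_closed[OF density_op_linear] unfolding nat
    by (simp add: functional_simps) (simp add: density_op_def functional_simps algebra_simps numeral_2_eq_2)
qed (use m linear_map_closed[OF density_op_linear] in auto)

end

text \<open>
  The linear extension to the Laurent polynomials of a function on the basis \<open>L\<^sub>k\<close>. The action of
  \<^const>\<open>witt\<close> defined below becomes such an extension after applying a functional.
\<close>

definition lin_ext :: "(int \<Rightarrow> complex) \<Rightarrow> (int \<Rightarrow>\<^sub>0 complex) \<Rightarrow> complex" where
  "lin_ext \<phi> x = (\<Sum>k\<in>Poly_Mapping.keys x. Poly_Mapping.lookup x k * \<phi> k)"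

lemma lin_ext_superset:
  assumes "finite A" "Poly_Mapping.keys x \<subseteq> A"
  shows "lin_ext \<phi> x = (\<Sum>k\<in>A. Poly_Mapping.lookup x k * \<phi> k)"
  unfolding lin_ext_def using assms by (intro sum.mono_neutral_left) (auto simp: in_keys_iff)

lemma lin_ext_add: "lin_ext \<phi> (x + y) = lin_ext \<phi> x + lin_ext \<phi> y"
proof -
  let ?A = "Poly_Mapping.keys x \<union> Poly_Mapping.keys y"
  have "lin_ext \<phi> z = (\<Sum>k\<in>?A. Poly_Mapping.lookup z k * \<phi> k)" if "z \<in> {x, y, x + y}" for z
    using that Poly_Mapping.keys_add[of x y] by (intro lin_ext_superset) auto
  then show ?thesis by (simp add: lookup_add algebra_simps sum.distrib)
qed

lemma lin_ext_single: "lin_ext \<phi> (Poly_Mapping.single k a) = a * \<phi> k"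
  by (subst lin_ext_superset[of "{k}"]) auto

lemma lin_ext_sum: "lin_ext \<phi> (sum f A) = (\<Sum>i\<in>A. lin_ext \<phi> (f i))"
  by (induction A rule: infinite_finite_induct) (auto simp: lin_ext_add, auto simp: lin_ext_def)

lemma lin_ext_scale: "lin_ext \<phi> (Poly_Mapping.map ((*) a) x) = a * lin_ext \<phi> x"
proof -
  have "lin_ext \<phi> (Poly_Mapping.map ((*) a) x) =
      (\<Sum>k\<in>Poly_Mapping.keys x. Poly_Mapping.lookup (Poly_Mapping.map ((*) a) x) k * \<phi> k)"
    by (intro lin_ext_superset) (auto simp: in_keys_iff lookup_scale)
  then show ?thesis
    by (simp add: lin_ext_def sum_distrib_left lookup_scale mult.assoc)
qed

text \<open>
  The operator \<open>A n\<close> is the action of \<open>L\<^sub>n\<^sub>-\<^sub>1\<close>. The structure of vector space and all other fields of the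
  record are copied from \<^term>\<open>M\<close>, since restriction to
  \<open>sl(2)\<close> has to give back \<^term>\<open>M\<close> on the nose.
\<close>

definition witt_rep :: "('g, 'v) lie_rep \<Rightarrow> (nat \<Rightarrow> 'v \<Rightarrow> 'v) \<Rightarrow> (int \<Rightarrow>\<^sub>0 complex, 'v) lie_rep" where
  "witt_rep M A = \<lparr>carrier = carrier M, monoid.mult = monoid.mult M, one = one M,
     zero = zero M, add = add M, smult = smult M,
     act = (\<lambda>x\<in>carrier witt. \<lambda>m\<in>carrier M.
       \<Oplus>\<^bsub>M\<^esub>k\<in>Poly_Mapping.keys x. Poly_Mapping.lookup x k \<odot>\<^bsub>M\<^esub> A (nat (k + 1)) m)\<rparr>"

lemma witt_rep_simps [simp]:
  "carrier (witt_rep M A) = carrier M" "monoid.mult (witt_rep M A) = monoid.mult M"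
  "one (witt_rep M A) = one M" "zero (witt_rep M A) = zero M" "add (witt_rep M A) = add M"
  "smult (witt_rep M A) = smult M" "a_minus (witt_rep M A) = a_minus M"
  by (simp_all add: witt_rep_def fun_eq_iff a_minus_def a_inv_def m_inv_def)

locale witt_ops = complex_space M for M :: "('g, 'v) lie_rep" (structure) +
  fixes A :: "nat \<Rightarrow> 'v \<Rightarrow> 'v"
  assumes A: "linear_map M M (A n)"
    and commutator: "m \<in> carrier M \<Longrightarrow> A i (A j m) \<ominus> A j (A i m) = (of_nat i - of_nat j) \<odot> A (i + j - 1) m"
begin

lemma complex_space: "complex_space M" ..

lemmas A_closed [simp] = linear_map_closed[OF A]

lemma act_closed:
  "x \<in> carrier witt \<Longrightarrow> m \<in> carrier M \<Longrightarrow> act (witt_rep M A) x m \<in> carrier M"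
  by (auto simp: witt_rep_def intro!: finsum_closed)

lemma functional_act:
  assumes "x \<in> carrier witt" "m \<in> carrier M" "functional g"
  shows "g (act (witt_rep M A) x m) = lin_ext (\<lambda>k. g (A (nat (k + 1)) m)) x"
  using assms by (simp add: witt_rep_def functional_finsum functional_scale lin_ext_def)

lemma functional_commutator:
  assumes "i \<ge> -1" "j \<ge> -1" "m \<in> carrier M" "functional g"
  shows "g (A (nat (i + 1)) (A (nat (j + 1)) m)) - g (A (nat (j + 1)) (A (nat (i + 1)) m))
    = of_int (i - j) * g (A (nat (i + j + 1)) m)"
proof -
  have "nat (i + 1) + nat (j + 1) - 1 = nat (i + j + 1)" using assms by linarith
  moreover have "of_nat (nat (i + 1)) - of_nat (nat (j + 1)) = (of_int (i - j) :: complex)"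
    using assms by simp
  ultimately have "A (nat (i + 1)) (A (nat (j + 1)) m) \<ominus> A (nat (j + 1)) (A (nat (i + 1)) m)
    = of_int (i - j) \<odot> A (nat (i + j + 1)) m"
    using commutator[OF assms(3), of "nat (i + 1)" "nat (j + 1)"] by simp
  then have "g (A (nat (i + 1)) (A (nat (j + 1)) m) \<ominus> A (nat (j + 1)) (A (nat (i + 1)) m))
    = g (of_int (i - j) \<odot> A (nat (i + j + 1)) m)" by simp
  then show ?thesis using assms by (simp add: functional_simps)
qed

lemma functional_act_act:
  assumes "x \<in> carrier witt" "y \<in> carrier witt" "m \<in> carrier M" "functional g"
  shows "g (act (witt_rep M A) x (act (witt_rep M A) y m)) =
    (\<Sum>i\<in>Poly_Mapping.keys x. \<Sum>j\<in>Poly_Mapping.keys y. Poly_Mapping.lookup x i * Poly_Mapping.lookup y j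
       * g (A (nat (i + 1)) (A (nat (j + 1)) m)))"
  using assms functional_act[OF assms(2,3) linear_map_functional[OF complex_space complex_space A assms(4)]]
  by (simp add: functional_act act_closed lin_ext_def sum_distrib_left mult.assoc)

lemma functional_act_bracket:
  assumes x: "x \<in> carrier witt" and y: "y \<in> carrier witt" and m: "m \<in> carrier M" and g: "functional g"
  shows "g (act (witt_rep M A) (bracket witt x y) m) =
    g (act (witt_rep M A) x (act (witt_rep M A) y m)) - g (act (witt_rep M A) y (act (witt_rep M A) x m))"
proof -
  have "g (act (witt_rep M A) (bracket witt x y) m) = (\<Sum>i\<in>Poly_Mapping.keys x. \<Sum>j\<in>Poly_Mapping.keys y.
      of_int (i - j) * Poly_Mapping.lookup x i * Poly_Mapping.lookup y j * g (A (nat (i + j + 1)) m))"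
    using functional_act[OF witt_bracket_closed[OF x y] m g]
    by (simp add: witt_def lin_ext_sum lin_ext_single)
  also have "\<dots> = (\<Sum>i\<in>Poly_Mapping.keys x. \<Sum>j\<in>Poly_Mapping.keys y. Poly_Mapping.lookup x i * Poly_Mapping.lookup y j
       * (g (A (nat (i + 1)) (A (nat (j + 1)) m)) - g (A (nat (j + 1)) (A (nat (i + 1)) m))))"
    using x y by (intro sum.cong refl, subst functional_commutator[OF _ _ m g]) (auto simp: witt_def)
  also have "\<dots> = g (act (witt_rep M A) x (act (witt_rep M A) y m)) - g (act (witt_rep M A) y (act (witt_rep M A) x m))"
    unfolding functional_act_act[OF x y m g] functional_act_act[OF y x m g]
      sum.swap[of _ "Poly_Mapping.keys x" "Poly_Mapping.keys y"]
    by (simp add: algebra_simps sum_subtractf)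
  finally show ?thesis .
qed

lemma is_lie_rep_witt_rep: "is_lie_rep witt (witt_rep M A)"
  unfolding is_lie_rep_def
proof (intro conjI ballI allI)
  show "Module.module complex_field (witt_rep M A)"
    using complex_space_cong[OF complex_space, of "witt_rep M A"] by (simp add: complex_space_def)
  show "act (witt_rep M A) \<in> extensional (carrier witt)"
    by (simp add: witt_rep_def)
next
  fix x assume "x \<in> carrier witt"
  then show "act (witt_rep M A) x \<in> carrier (witt_rep M A) \<rightarrow>\<^sub>E carrier (witt_rep M A)"
    using act_closed by (auto simp: PiE_iff) (auto simp: witt_rep_def extensional_def)
next
  fix x m n assume *: "x \<in> carrier witt" "m \<in> carrier (witt_rep M A)" "n \<in> carrier (witt_rep M A)"
  have "act (witt_rep M A) x (m \<oplus> n) = act (witt_rep M A) x m \<oplus> act (witt_rep M A) x n"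
    by (rule functional_eqI)
       (use * in \<open>auto simp: functional_simps functional_act act_closed linear_map_add[OF A] lin_ext_def
          algebra_simps sum.distrib\<close>)
  then show "act (witt_rep M A) x (m \<oplus>\<^bsub>witt_rep M A\<^esub> n)
      = act (witt_rep M A) x m \<oplus>\<^bsub>witt_rep M A\<^esub> act (witt_rep M A) x n" by simp
next
  fix a x m assume *: "x \<in> carrier witt" "m \<in> carrier (witt_rep M A)"
  have "act (witt_rep M A) x (a \<odot> m) = a \<odot> act (witt_rep M A) x m"
    by (rule functional_eqI)
       (use * in \<open>auto simp: functional_simps functional_act act_closed linear_map_scale[OF A] lin_ext_def
          algebra_simps sum_distrib_left\<close>)
  then show "act (witt_rep M A) x (a \<odot>\<^bsub>witt_rep M A\<^esub> m) = a \<odot>\<^bsub>witt_rep M A\<^esub> act (witt_rep M A) x m" by simp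
  have ax: "a \<odot>\<^bsub>witt\<^esub> x \<in> carrier witt" using * witt_smult_closed by blast
  have "act (witt_rep M A) (a \<odot>\<^bsub>witt\<^esub> x) m = a \<odot> act (witt_rep M A) x m"
    by (rule functional_eqI)
       (use * ax in \<open>auto simp: functional_simps functional_act act_closed\<close>, simp add: witt_def lin_ext_scale)
  then show "act (witt_rep M A) (a \<odot>\<^bsub>witt\<^esub> x) m = a \<odot>\<^bsub>witt_rep M A\<^esub> act (witt_rep M A) x m" by simp
next
  fix x y m assume *: "x \<in> carrier witt" "y \<in> carrier witt" "m \<in> carrier (witt_rep M A)"
  have xy: "x \<oplus>\<^bsub>witt\<^esub> y \<in> carrier witt"
    using * Poly_Mapping.keys_add[of x y] by (auto simp: witt_def)
  have "act (witt_rep M A) (x \<oplus>\<^bsub>witt\<^esub> y) m = act (witt_rep M A) x m \<oplus> act (witt_rep M A) y m"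
    by (rule functional_eqI)
       (use * xy in \<open>auto simp: functional_simps functional_act act_closed\<close>, simp add: witt_def lin_ext_add)
  then show "act (witt_rep M A) (x \<oplus>\<^bsub>witt\<^esub> y) m
      = act (witt_rep M A) x m \<oplus>\<^bsub>witt_rep M A\<^esub> act (witt_rep M A) y m" by simp
  have "act (witt_rep M A) (bracket witt x y) m =
      act (witt_rep M A) x (act (witt_rep M A) y m) \<ominus> act (witt_rep M A) y (act (witt_rep M A) x m)"
    by (rule functional_eqI)
       (use * witt_bracket_closed in \<open>auto simp: functional_simps functional_act_bracket act_closed\<close>)
  then show "act (witt_rep M A) (bracket witt x y) m = act (witt_rep M A) x (act (witt_rep M A) y m)
      \<ominus>\<^bsub>witt_rep M A\<^esub> act (witt_rep M A) y (act (witt_rep M A) x m)" by simp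
qed

end

section \<open>The Casimir operator on representations of $\mathfrak{sl}(2)$\<close>

locale sl2_rep =
  fixes M :: "(complex^2^2, 'v) lie_rep" (structure)
  assumes rep: "is_lie_rep sl2 M"

sublocale sl2_rep \<subseteq> complex_space M
  using rep by (simp add: is_lie_rep_def complex_space_def)

context sl2_rep
begin

abbreviation "e \<equiv> act M sl2_e"
abbreviation "f \<equiv> act M sl2_f"
abbreviation "h \<equiv> act M sl2_h"

lemma complex_space: "complex_space M" ..

lemma act_linear: "x \<in> carrier sl2 \<Longrightarrow> linear_map M M (act M x)"
  using rep by (auto simp: is_lie_rep_def linear_map_def)

lemmas e_linear = act_linear[OF sl2_basis(1)]
lemmas f_linear = act_linear[OF sl2_basis(2)]
lemmas h_linear = act_linear[OF sl2_basis(3)]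

lemmas efh_closed [simp] = linear_map_closed[OF e_linear] linear_map_closed[OF f_linear] linear_map_closed[OF h_linear]

lemmas efh_linear =
  linear_map_add[OF e_linear] linear_map_add[OF f_linear] linear_map_add[OF h_linear]
  linear_map_scale[OF e_linear] linear_map_scale[OF f_linear] linear_map_scale[OF h_linear]
  linear_map_diff[OF complex_space complex_space e_linear] linear_map_diff[OF complex_space complex_space f_linear]
  linear_map_diff[OF complex_space complex_space h_linear]

lemma act_scale: "x \<in> carrier sl2 \<Longrightarrow> m \<in> carrier M \<Longrightarrow> act M (a \<odot>\<^bsub>sl2\<^esub> x) m = a \<odot> act M x m"
  using rep by (auto simp: is_lie_rep_def)

lemma act_add: "x \<in> carrier sl2 \<Longrightarrow> y \<in> carrier sl2 \<Longrightarrow> m \<in> carrier M \<Longrightarrow>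
    act M (x \<oplus>\<^bsub>sl2\<^esub> y) m = act M x m \<oplus> act M y m"
  using rep by (auto simp: is_lie_rep_def)

lemma act_bracket: "x \<in> carrier sl2 \<Longrightarrow> y \<in> carrier sl2 \<Longrightarrow> m \<in> carrier M \<Longrightarrow>
    act M x (act M y m) \<ominus> act M y (act M x m) = act M (bracket sl2 x y) m"
  using rep by (auto simp: is_lie_rep_def)

text \<open>
  Used as rewrite rules, the commutation relations move \<open>f\<close> to the left and \<open>e\<close> to the right, so
  they bring every word in \<open>e\<close>, \<open>f\<close>, \<open>h\<close> into the normal order of the Poincare-Birkhoff-Witt theorem.
\<close>

lemma pbw_rules:
  assumes m: "m \<in> carrier M"
  shows "e (f m) = f (e m) \<oplus> h m" "h (f m) = f (h m) \<ominus> 2 \<odot> f m" "e (h m) = h (e m) \<ominus> 2 \<odot> e m"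
proof -
  have *: "e (f m) \<ominus> f (e m) = h m" "h (e m) \<ominus> e (h m) = 2 \<odot> e m" "h (f m) \<ominus> f (h m) = (-2) \<odot> f m"
    using m act_bracket[OF sl2_basis(1,2) m] act_bracket[OF sl2_basis(3,1) m] act_bracket[OF sl2_basis(3,2) m]
    by (simp_all only: sl2_basis act_scale)
  have **: "g (e (f m)) - g (f (e m)) = g (h m)" "g (h (e m)) - g (e (h m)) = 2 * g (e m)"
      "g (h (f m)) - g (f (h m)) = -2 * g (f m)"
    if "functional g" for g
    using that m *[THEN arg_cong[of _ _ g]] by (simp_all add: functional_simps)
  show "e (f m) = f (e m) \<oplus> h m" "h (f m) = f (h m) \<ominus> 2 \<odot> f m" "e (h m) = h (e m) \<ominus> 2 \<odot> e m"
    by (rule functional_eqI; use m ** in \<open>force simp: functional_simps algebra_simps\<close>)+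
qed

lemma casimir_closed [simp]: "m \<in> carrier M \<Longrightarrow> casimir M m \<in> carrier M"
  by (simp add: casimir_def Let_def)

lemma functional_casimir:
  "m \<in> carrier M \<Longrightarrow> functional g \<Longrightarrow> g (casimir M m) = g (h (h m)) + 2 * g (h m) + g m + 4 * g (f (e m))"
  by (simp add: casimir_def Let_def functional_simps efh_linear)

lemma casimir_linear: "linear_map M M (casimir M)"
  unfolding linear_map_def
proof (intro conjI ballI allI)
  fix x y assume "x \<in> carrier M" "y \<in> carrier M"
  then show "casimir M (x \<oplus> y) = casimir M x \<oplus> casimir M y"
    by (intro functional_eqI) (auto simp: functional_casimir functional_simps efh_linear algebra_simps)
next
  fix a x assume "x \<in> carrier M"
  then show "casimir M (a \<odot> x) = a \<odot> casimir M x"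
    by (intro functional_eqI) (auto simp: functional_casimir functional_simps efh_linear algebra_simps)
qed auto

lemma casimir_central:
  assumes m: "m \<in> carrier M"
  shows "f (casimir M m) = casimir M (f m)" "h (casimir M m) = casimir M (h m)"
  by (rule functional_eqI;
      use m in \<open>auto simp: functional_casimir functional_simps\<close>;
      use m in \<open>auto simp: casimir_def Let_def functional_simps efh_linear pbw_rules algebra_simps\<close>)+

text \<open>
  The operator \<open>c - (h - a)\<^sup>2\<close>. It is \<open>4fe\<close> for \<open>a = -1\<close> and \<open>4ef\<close> for \<open>a = 1\<close>, so its bijectivity
  controls that of \<open>f\<close>.
\<close>

definition ladder_factor :: "complex \<Rightarrow> 'v \<Rightarrow> 'v" where
  "ladder_factor a m = casimir M m \<ominus> (h (h m) \<ominus> (2 * a) \<odot> h m \<oplus> a\<^sup>2 \<odot> m)"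

lemma ladder_factor_closed [simp]: "m \<in> carrier M \<Longrightarrow> ladder_factor a m \<in> carrier M"
  by (simp add: ladder_factor_def)

lemma functional_ladder_factor:
  "m \<in> carrier M \<Longrightarrow> functional g \<Longrightarrow>
    g (ladder_factor a m) = g (casimir M m) - g (h (h m)) + 2 * a * g (h m) - a\<^sup>2 * g m"
  by (simp add: ladder_factor_def functional_simps)

lemma ladder_factor_fe: "m \<in> carrier M \<Longrightarrow> ladder_factor (-1) m = 4 \<odot> f (e m)"
  by (intro functional_eqI) (auto simp: functional_ladder_factor functional_casimir functional_simps)

lemma ladder_factor_ef: "m \<in> carrier M \<Longrightarrow> ladder_factor 1 m = 4 \<odot> e (f m)"
  by (intro functional_eqI) (auto simp: functional_ladder_factor functional_casimir functional_simps pbw_rules)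

lemma ladder_factor_linear: "linear_map M M (ladder_factor a)"
  unfolding linear_map_def
proof (intro conjI ballI allI)
  fix x y assume "x \<in> carrier M" "y \<in> carrier M"
  then show "ladder_factor a (x \<oplus> y) = ladder_factor a x \<oplus> ladder_factor a y"
    by (intro functional_eqI)
       (auto simp: functional_ladder_factor linear_map_add[OF casimir_linear] functional_simps efh_linear algebra_simps)
next
  fix b x assume "x \<in> carrier M"
  then show "ladder_factor a (b \<odot> x) = b \<odot> ladder_factor a x"
    by (intro functional_eqI)
       (auto simp: functional_ladder_factor linear_map_scale[OF casimir_linear] functional_simps efh_linear algebra_simps)
qed auto

text \<open>
  The operators \<open>h - \<mu>\<close> serve to annihilate a vector step by step: products of them, over lists
  of weights, replace the decomposition into weight vectors in the proof that
  \<^const>\<open>ladder_factor\<close> is injective.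
\<close>

definition h_minus :: "complex \<Rightarrow> 'v \<Rightarrow> 'v" where
  "h_minus \<mu> m = h m \<ominus> \<mu> \<odot> m"

lemma h_minus_linear: "linear_map M M (h_minus \<mu>)"
  unfolding linear_map_def
proof (intro conjI ballI allI)
  fix x y assume "x \<in> carrier M" "y \<in> carrier M"
  then show "h_minus \<mu> (x \<oplus> y) = h_minus \<mu> x \<oplus> h_minus \<mu> y"
    by (intro functional_eqI) (auto simp: h_minus_def functional_simps efh_linear algebra_simps)
next
  fix a x assume "x \<in> carrier M"
  then show "h_minus \<mu> (a \<odot> x) = a \<odot> h_minus \<mu> x"
    by (intro functional_eqI) (auto simp: h_minus_def functional_simps efh_linear algebra_simps)
qed (auto simp: h_minus_def)

lemmas h_minus_closed [simp] = linear_map_closed[OF h_minus_linear]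

lemma h_minus_zero [simp]: "h_minus \<mu> \<zero> = \<zero>"
  by (rule linear_map_zero[OF complex_space complex_space h_minus_linear])

lemma h_minus_eq_zero_iff: "m \<in> carrier M \<Longrightarrow> h_minus \<mu> m = \<zero> \<longleftrightarrow> m \<in> weight_space M \<mu>"
  by (simp add: h_minus_def weight_space_def diff_eq_zero_iff)

lemma h_minus_commute:
  "m \<in> carrier M \<Longrightarrow> h_minus \<mu> (h_minus \<nu> m) = h_minus \<nu> (h_minus \<mu> m)"
  by (intro functional_eqI) (auto simp: h_minus_def functional_simps efh_linear algebra_simps)

lemma ladder_factor_h_minus:
  "m \<in> carrier M \<Longrightarrow> ladder_factor a (h_minus \<mu> m) = h_minus \<mu> (ladder_factor a m)"
  by (intro functional_eqI)
     (auto simp: h_minus_def ladder_factor_def functional_simps efh_linear casimir_central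
       linear_map_diff[OF complex_space complex_space casimir_linear] linear_map_scale[OF casimir_linear] algebra_simps)

lemma fold_h_minus_closed [simp]: "m \<in> carrier M \<Longrightarrow> fold h_minus \<mu>s m \<in> carrier M"
  by (induction \<mu>s arbitrary: m) auto

lemma fold_h_minus_zero [simp]: "fold h_minus \<mu>s \<zero> = \<zero>"
  by (induction \<mu>s) auto

lemma fold_h_minus_add:
  "x \<in> carrier M \<Longrightarrow> y \<in> carrier M \<Longrightarrow> fold h_minus \<mu>s (x \<oplus> y) = fold h_minus \<mu>s x \<oplus> fold h_minus \<mu>s y"
  by (induction \<mu>s arbitrary: x y) (auto simp: linear_map_add[OF h_minus_linear])

lemma fold_h_minus_h_minus: "m \<in> carrier M \<Longrightarrow> fold h_minus \<mu>s (h_minus \<nu> m) = h_minus \<nu> (fold h_minus \<mu>s m)"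
proof (induction \<mu>s arbitrary: m)
  case (Cons \<mu> \<mu>s)
  then show ?case using h_minus_commute[of m \<mu> \<nu>] by simp
qed simp

lemma fold_h_minus_commute:
  "m \<in> carrier M \<Longrightarrow> fold h_minus \<mu>s (fold h_minus \<nu>s m) = fold h_minus \<nu>s (fold h_minus \<mu>s m)"
  by (induction \<nu>s arbitrary: m) (auto simp: fold_h_minus_h_minus)

end

section \<open>The operators of the Witt action\<close>

definition casimir_shift :: "(complex^2^2, 'v) lie_rep \<Rightarrow> complex \<Rightarrow> 'v \<Rightarrow> 'v" where
  "casimir_shift M \<tau> = (\<lambda>v. casimir M v \<ominus>\<^bsub>M\<^esub> \<tau> \<odot>\<^bsub>M\<^esub> v)"

text \<open>
  The square root of \<open>c = s\<^sup>2 + (c - s\<^sup>2)\<close> that is congruent to \<open>s\<close> modulo a locally nilpotent operator.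
\<close>

definition casimir_root :: "(complex^2^2, 'v) lie_rep \<Rightarrow> complex \<Rightarrow> 'v \<Rightarrow> 'v" where
  "casimir_root M s = fps_op M (fps_radical (\<lambda>_ _. s) 2 (fps_const (s\<^sup>2) + fps_X)) (casimir_shift M (s\<^sup>2))"

text \<open>
  On densities of weight \<open>b\<close> the Casimir operator is \<open>(2b - 1)\<^sup>2\<close>, whence \<open>2b - 1 = \<surd>c\<close>.
\<close>

definition density_weight :: "(complex^2^2, 'v) lie_rep \<Rightarrow> complex \<Rightarrow> 'v \<Rightarrow> 'v" where
  "density_weight M s m = (1/2) \<odot>\<^bsub>M\<^esub> (m \<oplus>\<^bsub>M\<^esub> casimir_root M s m)"

text \<open>
  On densities \<open>h = 2(z\<partial> + b)\<close> and \<open>f = -\<partial>\<close>, so that \<open>z f = b - h/2\<close>. This determines multiplication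
  by \<open>z\<close> as soon as \<open>f\<close> is invertible.
\<close>

definition coord_op :: "(complex^2^2, 'v) lie_rep \<Rightarrow> complex \<Rightarrow> 'v \<Rightarrow> 'v" where
  "coord_op M s m = (let n = inv_into (carrier M) (act M sl2_f) m
     in density_weight M s n \<ominus>\<^bsub>M\<^esub> (1/2) \<odot>\<^bsub>M\<^esub> act M sl2_h n)"

text \<open>
  A module in the block of \<open>\<xi>\<close> and \<open>s\<^sup>2\<close>, with the conditions on \<open>\<xi>\<close> and \<open>s\<close> that make \<open>f\<close> bijective and
  give \<open>c\<close> a square root.
\<close>

locale generic_block = sl2_rep M for M :: "(complex^2^2, 'v) lie_rep" (structure) +
  fixes \<xi> :: "complex set" and s :: complex
  assumes weight_module: "weight_module M"
    and supp: "weight_supp M \<subseteq> \<xi>"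
    and casimir_nilpotent: "\<mu> \<in> \<xi> \<Longrightarrow> \<exists>n. \<forall>m\<in>weight_space M \<mu>. (casimir_shift M (s\<^sup>2) ^^ n) m = \<zero>"
    and shift: "\<mu> \<in> \<xi> \<Longrightarrow> \<mu> - 2 \<in> \<xi>"
    and generic: "\<mu> \<in> \<xi> \<Longrightarrow> s\<^sup>2 \<noteq> (\<mu> + 1)\<^sup>2"
    and s_nz: "s \<noteq> 0"
begin

abbreviation "\<tau> \<equiv> s\<^sup>2"
abbreviation "N \<equiv> casimir_shift M \<tau>"

lemma weight_induct [consumes 1, case_names zero add weight]:
  assumes "m \<in> carrier M" and zero: "P \<zero>"
    and add: "\<And>x y. x \<in> carrier M \<Longrightarrow> y \<in> carrier M \<Longrightarrow> P x \<Longrightarrow> P y \<Longrightarrow> P (x \<oplus> y)"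
    and weight: "\<And>\<mu> v. \<mu> \<in> \<xi> \<Longrightarrow> v \<in> carrier M \<Longrightarrow> v \<in> weight_space M \<mu> \<Longrightarrow> P v"
  shows "P m"
proof -
  obtain u where u: "\<forall>\<mu>. u \<mu> \<in> weight_space M \<mu>" and m: "m = (\<Oplus>\<mu>\<in>{\<mu>. u \<mu> \<noteq> \<zero>}. u \<mu>)"
    using weight_module assms(1) unfolding weight_module_def by blast
  have uc: "u \<mu> \<in> carrier M" for \<mu> using u by (auto simp: weight_space_def)
  have Pu: "P (u \<mu>)" for \<mu>
  proof (cases "\<mu> \<in> \<xi>")
    case True
    then show ?thesis using weight u uc by blast
  next
    case False
    then have "u \<mu> = \<zero>" using supp u by (auto simp: weight_supp_def)
    then show ?thesis using zero by simp
  qed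
  have "P (finsum M u A)" for A
  proof (induction A rule: infinite_finite_induct)
    case (insert \<mu> A)
    then show ?case using uc Pu add by (subst finsum_insert) (auto intro!: finsum_closed)
  qed (use zero in auto)
  then show ?thesis using m by simp
qed

lemma N_linear: "linear_map M M N"
  unfolding linear_map_def
proof (intro conjI ballI allI)
  fix x y assume "x \<in> carrier M" "y \<in> carrier M"
  then show "N (x \<oplus> y) = N x \<oplus> N y"
    by (intro functional_eqI)
       (auto simp: casimir_shift_def linear_map_add[OF casimir_linear] functional_simps algebra_simps)
next
  fix a x assume "x \<in> carrier M"
  then show "N (a \<odot> x) = a \<odot> N x"
    by (intro functional_eqI)
       (auto simp: casimir_shift_def linear_map_scale[OF casimir_linear] functional_simps algebra_simps)
qed (auto simp: casimir_shift_def)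

lemma N_f: "m \<in> carrier M \<Longrightarrow> f (N m) = N (f m)"
  and N_h: "m \<in> carrier M \<Longrightarrow> h (N m) = N (h m)"
  by (auto simp: casimir_shift_def efh_linear casimir_central)

text \<open>
  Each weight space has its own exponent of nilpotency; a single vector meets only finitely many
  weight spaces.
\<close>

sublocale N: locally_nilpotent M N
proof
  show "\<exists>n. (N ^^ n) m = \<zero>" if "m \<in> carrier M" for m
    using that
  proof (induction m rule: weight_induct)
    case zero
    have "(N ^^ 0) \<zero> = \<zero>" by simp
    then show ?case by blast
  next
    case (add x y)
    then obtain i j where ij: "(N ^^ i) x = \<zero>" "(N ^^ j) y = \<zero>" by blast
    note lin = linear_map_funpow[OF N_linear]
    note z = linear_map_zero[OF complex_space complex_space lin]
    have "(N ^^ (j + i)) x = \<zero>" "(N ^^ (i + j)) y = \<zero>"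
      using ij z by (simp_all only: funpow_add comp_apply)
    then have "(N ^^ (i + j)) (x \<oplus> y) = \<zero>"
      using add(1,2) by (simp add: linear_map_add[OF lin] add.commute)
    then show ?case by blast
  next
    case (weight \<mu> v)
    then show ?case using casimir_nilpotent by blast
  qed
qed (rule N_linear)

lemma ladder_factor_weight:
  assumes "v \<in> weight_space M \<mu>"
  shows "ladder_factor a v = (\<tau> - (\<mu> - a)\<^sup>2) \<odot> v \<oplus> N v"
proof -
  have v: "v \<in> carrier M" "h v = \<mu> \<odot> v" using assms by (auto simp: weight_space_def)
  show ?thesis
    by (rule functional_eqI)
       (use v in \<open>auto simp: functional_ladder_factor casimir_shift_def functional_simps efh_linear
          power2_eq_square algebra_simps linear_map_closed[OF N_linear]\<close>)
qed

lemma fps_op_N_h: "m \<in> carrier M \<Longrightarrow> h (fps_op M F N m) = fps_op M F N (h m)"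
  and fps_op_N_f: "m \<in> carrier M \<Longrightarrow> f (fps_op M F N m) = fps_op M F N (f m)"
  using N.fps_op_natural[OF N.locally_nilpotent_axioms h_linear N_h]
    N.fps_op_natural[OF N.locally_nilpotent_axioms f_linear N_f] by auto

text \<open>
  By \<open>ladder_factor_weight\<close> the operator is a nonzero number plus a nilpotent one on each weight space,
  hence invertible there; the preimage of a weight vector is a power series in \<open>N\<close> applied to it.
\<close>

lemma ladder_factor_surj:
  assumes a: "\<And>\<mu>. \<mu> \<in> \<xi> \<Longrightarrow> \<tau> \<noteq> (\<mu> - a)\<^sup>2" and m: "m \<in> carrier M"
  shows "\<exists>n\<in>carrier M. ladder_factor a n = m"
  using m
proof (induction m rule: weight_induct)
  case zero
  then show ?case
    using linear_map_zero[OF complex_space complex_space ladder_factor_linear] by blast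
next
  case (add x y)
  then obtain x' y' where "x' \<in> carrier M" "y' \<in> carrier M" "ladder_factor a x' = x" "ladder_factor a y' = y"
    by blast
  then show ?case
    by (intro bexI[of _ "x' \<oplus> y'"]) (simp_all add: linear_map_add[OF ladder_factor_linear])
next
  case (weight \<mu> v)
  then have "\<tau> - (\<mu> - a)\<^sup>2 \<noteq> 0" using a by simp
  then obtain G where G: "\<And>m. m \<in> carrier M \<Longrightarrow> (\<tau> - (\<mu> - a)\<^sup>2) \<odot> fps_op M G N m \<oplus> N (fps_op M G N m) = m"
    using N.ex_inverse_shift by metis
  have "h (fps_op M G N v) = fps_op M G N (\<mu> \<odot> v)"
    using weight by (simp add: fps_op_N_h weight_space_def)
  also have "\<dots> = \<mu> \<odot> fps_op M G N v"
    using weight(2) by (rule linear_map_scale[OF N.fps_op_linear])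
  finally have "fps_op M G N v \<in> weight_space M \<mu>"
    using weight by (simp add: weight_space_def)
  then have "ladder_factor a (fps_op M G N v) = v"
    using G weight by (simp add: ladder_factor_weight)
  then show ?case using weight by (intro bexI[of _ "fps_op M G N v"]) auto
qed

lemma ex_annihilating_weights:
  assumes "m \<in> carrier M"
  shows "\<exists>\<mu>s. set \<mu>s \<subseteq> \<xi> \<and> fold h_minus \<mu>s m = \<zero>"
  using assms
proof (induction m rule: weight_induct)
  case zero
  show ?case by (intro exI[of _ "[]"]) auto
next
  case (add x y)
  then obtain \<mu>s \<nu>s where "set \<mu>s \<subseteq> \<xi>" "fold h_minus \<mu>s x = \<zero>" "set \<nu>s \<subseteq> \<xi>" "fold h_minus \<nu>s y = \<zero>"
    by blast
  then show ?case
    using add(1,2) fold_h_minus_commute[of y \<nu>s \<mu>s]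
    by (intro exI[of _ "\<mu>s @ \<nu>s"]) (auto simp: fold_h_minus_add)
next
  case (weight \<mu> v)
  then show ?case by (intro exI[of _ "[\<mu>]"]) (auto simp: h_minus_eq_zero_iff)
qed

text \<open>
  Take a product of factors \<open>h - \<mu>\<close> that kills \<open>m\<close> and remove one factor at a time. As
  \<open>(h - \<mu>) m\<close> is killed by \<^const>\<open>ladder_factor\<close> and by a shorter product, it is zero by induction;
  so \<open>m\<close> is a weight vector, and on weight vectors injectivity is clear.
\<close>

lemma ladder_factor_inj:
  assumes a: "\<And>\<mu>. \<mu> \<in> \<xi> \<Longrightarrow> \<tau> \<noteq> (\<mu> - a)\<^sup>2" and m: "m \<in> carrier M" and zero: "ladder_factor a m = \<zero>"
  shows "m = \<zero>"
proof -
  obtain \<mu>s where "set \<mu>s \<subseteq> \<xi>" "fold h_minus \<mu>s m = \<zero>" using ex_annihilating_weights[OF m] by blast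
  then show ?thesis using m zero
  proof (induction \<mu>s arbitrary: m)
    case (Cons \<mu> \<mu>s)
    from Cons.prems have "h_minus \<mu> m = \<zero>"
      using Cons.IH[of "h_minus \<mu> m"] by (simp add: ladder_factor_h_minus)
    then have w: "m \<in> weight_space M \<mu>" using Cons.prems by (simp add: h_minus_eq_zero_iff)
    have "\<tau> - (\<mu> - a)\<^sup>2 \<noteq> 0" using a[of \<mu>] Cons.prems by simp
    then obtain G where G: "\<And>m. m \<in> carrier M \<Longrightarrow> fps_op M G N ((\<tau> - (\<mu> - a)\<^sup>2) \<odot> m \<oplus> N m) = m"
      using N.ex_inverse_shift by metis
    have "fps_op M G N (ladder_factor a m) = m"
      unfolding ladder_factor_weight[OF w] using Cons.prems(3) by (rule G)
    then show ?case
      using Cons.prems linear_map_zero[OF complex_space complex_space N.fps_op_linear] by simp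
  qed simp
qed

text \<open>
  Injectivity comes from that of \<open>4ef = c - (h - 1)\<^sup>2\<close>, surjectivity from that of
  \<open>4fe = c - (h + 1)\<^sup>2\<close>. The former involves \<open>(\<mu> - 1)\<^sup>2\<close>, which is excluded as a value of \<open>s\<^sup>2\<close>
  because \<open>\<mu> - 2 \<in> \<xi>\<close>.
\<close>

lemma f_bij: "bij_betw f (carrier M) (carrier M)"
proof (rule bij_betw_imageI)
  show "inj_on f (carrier M)"
  proof (rule inj_onI)
    fix x y assume xy: "x \<in> carrier M" "y \<in> carrier M" "f x = f y"
    have "f (x \<ominus> y) = \<zero>" using xy by (simp add: efh_linear diff_eq_zero_iff)
    then have "ladder_factor 1 (x \<ominus> y) = \<zero>"
      using xy linear_map_zero[OF complex_space complex_space e_linear] by (simp add: ladder_factor_ef)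
    moreover have "\<tau> \<noteq> (\<mu> - 1)\<^sup>2" if "\<mu> \<in> \<xi>" for \<mu>
      using generic[OF shift[OF that]] by simp
    ultimately show "x = y" using ladder_factor_inj[of 1 "x \<ominus> y"] xy by (simp add: diff_eq_zero_iff)
  qed
  show "f ` carrier M = carrier M"
  proof (intro equalityI subsetI)
    fix m assume "m \<in> carrier M"
    then obtain n where n: "n \<in> carrier M" "ladder_factor (-1) n = m"
      using ladder_factor_surj[of "-1" m] generic by auto
    then have "m = f (4 \<odot> e n)" by (auto simp: ladder_factor_fe efh_linear)
    with n(1) show "m \<in> f ` carrier M" by (intro image_eqI[of m f "4 \<odot> e n"]) simp_all
  qed auto
qed

abbreviation "S \<equiv> casimir_root M s"
abbreviation "B \<equiv> density_weight M s"
abbreviation "Z \<equiv> coord_op M s"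

lemma S_linear: "linear_map M M S"
  unfolding casimir_root_def by (rule N.fps_op_linear)

lemmas S_closed [simp] = linear_map_closed[OF S_linear]

lemma S_square: "m \<in> carrier M \<Longrightarrow> S (S m) = casimir M m"
  using N.fps_op_square_root[of s \<tau> m] s_nz
  by (simp add: casimir_root_def) (rule functional_eqI; auto simp: casimir_shift_def functional_simps)

lemma S_h: "m \<in> carrier M \<Longrightarrow> h (S m) = S (h m)"
  and S_f: "m \<in> carrier M \<Longrightarrow> f (S m) = S (f m)"
  by (simp_all add: casimir_root_def fps_op_N_h fps_op_N_f)

lemma B_linear: "linear_map M M B"
  unfolding linear_map_def
proof (intro conjI ballI allI)
  fix x y assume "x \<in> carrier M" "y \<in> carrier M"
  then show "B (x \<oplus> y) = B x \<oplus> B y"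
    by (intro functional_eqI)
       (auto simp: density_weight_def linear_map_add[OF S_linear] functional_simps algebra_simps)
next
  fix a x assume "x \<in> carrier M"
  then show "B (a \<odot> x) = a \<odot> B x"
    by (intro functional_eqI)
       (auto simp: density_weight_def linear_map_scale[OF S_linear] functional_simps algebra_simps)
qed (auto simp: density_weight_def)

lemmas B_closed [simp] = linear_map_closed[OF B_linear]

lemmas B_lin = linear_map_add[OF B_linear] linear_map_scale[OF B_linear]
  linear_map_diff[OF complex_space complex_space B_linear]

lemma B_h: "m \<in> carrier M \<Longrightarrow> h (B m) = B (h m)"
  and B_f: "m \<in> carrier M \<Longrightarrow> f (B m) = B (f m)"
  by (simp_all add: density_weight_def efh_linear S_h S_f)

text \<open>
  This is \<open>(2B - 1)\<^sup>2 = c\<close>, solved for \<open>B\<^sup>2\<close>.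
\<close>

lemma B_quadratic:
  "m \<in> carrier M \<Longrightarrow> functional g \<Longrightarrow> g (B (B m)) = g (B m) + (g (casimir M m) - g m) / 4"
  by (simp add: density_weight_def linear_map_add[OF S_linear] linear_map_scale[OF S_linear] S_square
      functional_simps field_simps)

lemma Z_f: "n \<in> carrier M \<Longrightarrow> Z (f n) = B n \<ominus> (1/2) \<odot> h n"
  using bij_betw_imp_inj_on[OF f_bij] by (simp add: coord_op_def)

lemma f_preimage:
  assumes "m \<in> carrier M" obtains n where "n \<in> carrier M" "m = f n"
  using bij_betw_imp_surj_on[OF f_bij] assms by blast

lemma Z_linear: "linear_map M M Z"
  unfolding linear_map_def
proof (intro conjI ballI allI Pi_I)
  fix x assume "x \<in> carrier M"
  then obtain m where m: "m \<in> carrier M" "x = f m" by (rule f_preimage)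
  then show "Z x \<in> carrier M" by (simp add: Z_f)
  show "Z (a \<odot> x) = a \<odot> Z x" for a
  proof -
    have "Z (a \<odot> x) = B (a \<odot> m) \<ominus> (1/2) \<odot> h (a \<odot> m)"
      using m Z_f[of "a \<odot> m"] by (simp add: efh_linear)
    also have "\<dots> = a \<odot> Z x"
      using m by (intro functional_eqI) (auto simp: Z_f functional_simps efh_linear B_lin algebra_simps)
    finally show ?thesis .
  qed
  fix y assume "y \<in> carrier M"
  then obtain n where n: "n \<in> carrier M" "y = f n" by (rule f_preimage)
  have "Z (x \<oplus> y) = B (m \<oplus> n) \<ominus> (1/2) \<odot> h (m \<oplus> n)"
    using m n Z_f[of "m \<oplus> n"] by (simp add: efh_linear)
  also have "\<dots> = Z x \<oplus> Z y"
    using m n by (intro functional_eqI) (auto simp: Z_f functional_simps efh_linear B_lin algebra_simps)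
  finally show "Z (x \<oplus> y) = Z x \<oplus> Z y" .
qed

sublocale weyl: weyl_pair M Z f B
proof
  fix m assume "m \<in> carrier M"
  then obtain n where n: "n \<in> carrier M" "m = f n" by (rule f_preimage)
  then show "f (Z m) = Z (f m) \<ominus> m"
    by (intro functional_eqI)
       (auto simp: Z_f functional_simps efh_linear B_f pbw_rules algebra_simps linear_map_closed[OF Z_linear])
  show "B (Z m) = Z (B m)"
    using n(1) Z_f[of "B n"] by (simp add: n(2) B_f Z_f B_h B_lin)
  show "B (f m) = f (B m)" using n by (simp add: B_f)
qed (rule Z_linear f_linear B_linear)+

abbreviation "L \<equiv> density_op M Z f B"

sublocale witt_ops M L
  by unfold_locales (rule weyl.density_op_linear weyl.density_op_commutator; assumption)+

text \<open>
  The three operators attached to \<open>sl(2)\<close> are the given ones. For \<open>f\<close> and \<open>h\<close> this is how \<open>Z\<close> was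
  chosen; for \<open>e\<close> it is the choice of \<open>B\<close>: writing \<open>m = f n\<close>, both sides become expressions in \<open>h\<close>,
  \<open>B\<close> and \<open>c\<close> applied to \<open>n\<close>, which agree by \<open>B_quadratic\<close>.
\<close>

lemma L_sl2:
  assumes m: "m \<in> carrier M"
  shows "L 0 m = f m" "L 1 m = (-1/2) \<odot> h m" "L 2 m = (-1) \<odot> e m"
proof -
  show "L 0 m = f m"
    using m by (intro functional_eqI) (auto simp: density_op_def functional_simps)
  show "L 1 m = (-1/2) \<odot> h m"
    using m by (intro functional_eqI) (auto simp: density_op_def functional_simps Z_f)
  obtain n where n: "n \<in> carrier M" "m = f n" using m by (rule f_preimage)
  show "L 2 m = (-1) \<odot> e m"
  proof (rule functional_eqI)
    fix g assume g: "functional g"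
    have Bm: "B m = f (B n)" using n by (simp add: B_f)
    have Zfm: "Z (f m) = f (B n \<ominus> (1/2) \<odot> h n \<oplus> n)"
      using n m by (intro functional_eqI) (auto simp: Z_f functional_simps efh_linear B_f pbw_rules algebra_simps)
    have "g (L 2 m) = g (Z (Z (f m))) - 2 * g (Z (B m))"
      using m g by (simp add: density_op_def functional_simps numeral_2_eq_2)
    also have "\<dots> = g (Z (f (B n \<ominus> (1/2) \<odot> h n \<oplus> n))) - 2 * g (Z (f (B n)))"
      by (simp only: Zfm Bm)
    also have "\<dots> = - g (B (B n)) + g (B n) + g (h (h n)) / 4 - g (h n) / 2"
      using n g by (subst (1 2) Z_f) (simp_all add: functional_simps efh_linear B_lin B_h algebra_simps)
    also have "\<dots> = - g (e m)"
      using n g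
      by (simp add: B_quadratic functional_simps functional_casimir pbw_rules add_divide_distrib)
    finally show "g (L 2 m) = g ((-1) \<odot> e m)"
      using m g by (simp add: functional_simps)
  qed (use m in auto)
qed

end

section \<open>Naturality and the functor\<close>

lemma casimir_natural:
  assumes "sl2_rep M" "sl2_rep N" "\<phi> \<in> rep_homs sl2 M N" "m \<in> carrier M"
  shows "\<phi> (casimir M m) = casimir N (\<phi> m)"
proof -
  interpret M: sl2_rep M by fact
  interpret N: sl2_rep N by fact
  show ?thesis
    using assms(3,4) sl2_basis(1-3) by (simp add: rep_homs_def casimir_def Let_def)
qed

locale generic_block_hom = M: generic_block M \<xi> s + N: generic_block N \<xi> s
  for M N :: "(complex^2^2, 'v) lie_rep" and \<xi> s +
  fixes \<phi> :: "'v \<Rightarrow> 'v"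
  assumes hom: "\<phi> \<in> rep_homs sl2 M N"
begin

lemma linear: "linear_map M N \<phi>"
  using hom by (auto simp: rep_homs_def linear_map_def)

lemmas closed [simp] = linear_map_closed[OF linear]

lemmas lin = linear_map_add[OF linear] linear_map_scale[OF linear]
  linear_map_diff[OF M.complex_space N.complex_space linear]

lemma hom_act: "m \<in> carrier M \<Longrightarrow> \<phi> (M.f m) = N.f (\<phi> m)" "m \<in> carrier M \<Longrightarrow> \<phi> (M.h m) = N.h (\<phi> m)"
  using hom sl2_basis(1-3) by (auto simp: rep_homs_def)

lemma hom_S: "m \<in> carrier M \<Longrightarrow> \<phi> (M.S m) = N.S (\<phi> m)"
  unfolding casimir_root_def
  by (rule M.N.fps_op_natural[OF N.N.locally_nilpotent_axioms linear])
     (simp_all add: casimir_shift_def lin casimir_natural[OF M.sl2_rep_axioms N.sl2_rep_axioms hom])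

lemma hom_B: "m \<in> carrier M \<Longrightarrow> \<phi> (M.B m) = N.B (\<phi> m)"
  by (simp add: density_weight_def lin hom_S)

lemma hom_Z: "m \<in> carrier M \<Longrightarrow> \<phi> (M.Z m) = N.Z (\<phi> m)"
proof -
  assume "m \<in> carrier M"
  then obtain n where n: "n \<in> carrier M" "m = M.f n" by (rule M.f_preimage)
  then show ?thesis by (simp add: M.Z_f N.Z_f lin hom_act hom_B)
qed

lemma hom_L: "m \<in> carrier M \<Longrightarrow> \<phi> (M.L k m) = N.L k (\<phi> m)"
  using funpow_intertwine[where \<phi> = \<phi> and T = M.Z and T' = N.Z, OF hom_Z M.Z_linear]
  by (simp add: density_op_def lin hom_act hom_B)

text \<open>
  All ingredients of the Witt action -- the Casimir operator, its square root, the inverse of \<open>f\<close> --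
  are defined from the \<open>sl(2)\<close>-action alone, so an \<open>sl(2)\<close>-homomorphism respects them. This is why
  the functor is full.
\<close>

lemma hom_witt_act:
  assumes x: "x \<in> carrier witt" and m: "m \<in> carrier M"
  shows "\<phi> (act (witt_rep M M.L) x m) = act (witt_rep N N.L) x (\<phi> m)"
proof (rule N.functional_eqI)
  fix g assume g: "N.functional g"
  show "g (\<phi> (act (witt_rep M M.L) x m)) = g (act (witt_rep N N.L) x (\<phi> m))"
    using M.functional_act[OF x m linear_map_functional[OF M.complex_space N.complex_space linear g]]
      N.functional_act[OF x closed[OF m] g] m
    by (simp add: hom_L)
qed (use x m M.act_closed N.act_closed in auto)

end

definition witt_functor :: "complex \<Rightarrow> ((complex^2^2, 'v) lie_rep, 'v \<Rightarrow> 'v, (int \<Rightarrow>\<^sub>0 complex, 'v) lie_rep, 'v \<Rightarrow> 'v) ftor" where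
  "witt_functor s = \<lparr>on_ob = (\<lambda>M. witt_rep M (density_op M (coord_op M s) (act M sl2_f) (density_weight M s))),
     on_hom = (\<lambda>M N \<phi>. \<phi>)\<rparr>"

lemma sl2_decomp:
  assumes "x \<in> carrier sl2"
  shows "x = (x $ 2 $ 1) \<odot>\<^bsub>sl2\<^esub> sl2_f \<oplus>\<^bsub>sl2\<^esub> (x $ 1 $ 1) \<odot>\<^bsub>sl2\<^esub> sl2_h \<oplus>\<^bsub>sl2\<^esub> (x $ 1 $ 2) \<odot>\<^bsub>sl2\<^esub> sl2_e"
  using assms
  by (auto simp: sl2_def sl2_e_def sl2_f_def sl2_h_def vec_eq_iff forall_2 trace_def sum_2 add_eq_0_iff)

text \<open>
  By \<open>L_sl2\<close> the two actions agree on the Chevalley basis, hence on \<^term>\<open>carrier sl2\<close>. The records are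
  then equal because both actions have the same default value off the carriers.
\<close>

lemma (in generic_block) restrict_witt_rep:
  "on_ob forget_functor (witt_rep M L) = M"
proof -
  have "act M x m = act (witt_rep M L) (sl2_to_witt x) m" if x: "x \<in> carrier sl2" and m: "m \<in> carrier M" for x m
  proof (rule functional_eqI)
    fix g assume g: "functional g"
    have w: "sl2_to_witt x \<in> carrier witt" using sl2_to_witt_hom x by (auto simp: is_lie_hom_def)
    have sl2_closed: "a \<odot>\<^bsub>sl2\<^esub> y \<in> carrier sl2" "y \<oplus>\<^bsub>sl2\<^esub> z \<in> carrier sl2" if "y \<in> carrier sl2" "z \<in> carrier sl2" for a y z
      using that by (auto simp: sl2_def trace_def sum_2) (simp_all add: algebra_simps flip: distrib_left)
    have "g (act M x m) = x $ 2 $ 1 * g (f m) + x $ 1 $ 1 * g (h m) + x $ 1 $ 2 * g (e m)"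
      using m g sl2_closed sl2_basis by (subst sl2_decomp[OF x]) (simp add: act_add act_scale functional_simps)
    then show "g (act M x m) = g (act (witt_rep M L) (sl2_to_witt x) m)"
      unfolding functional_act[OF w m g] using m g L_sl2[OF m]
      by (simp add: sl2_to_witt_def lin_ext_add lin_ext_single functional_simps)
  next
    show "act (witt_rep M L) (sl2_to_witt x) m \<in> carrier M"
      using sl2_to_witt_hom x by (intro act_closed m) (auto simp: is_lie_hom_def)
  qed (use act_linear[OF x] m in \<open>auto simp: linear_map_closed\<close>)
  moreover have "act M x \<in> extensional (carrier M)" if "x \<in> carrier sl2" for x
    using rep that by (auto simp: is_lie_rep_def PiE_iff)
  moreover have "act (witt_rep M L) (sl2_to_witt x) \<in> extensional (carrier M)" if "x \<in> carrier sl2" for x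
    using sl2_to_witt_hom that by (auto simp: is_lie_hom_def witt_rep_def)
  ultimately have "act M x = act (witt_rep M L) (sl2_to_witt x)" if "x \<in> carrier sl2" for x
    using that by (intro extensionalityI[of _ "carrier M"]) auto
  then have "act M = (\<lambda>x\<in>carrier sl2. act (witt_rep M L) (sl2_to_witt x))"
    using rep by (intro extensionalityI[of _ "carrier sl2"]) (auto simp: is_lie_rep_def)
  then show ?thesis
    by (simp add: forget_functor_def restriction_functor_def lie_rep.equality module.equality)
qed

lemma C_mod_2Z_shift:
  assumes "\<xi> \<in> C_mod_2Z" "\<mu> \<in> \<xi>"
  shows "\<mu> - 2 \<in> \<xi>"
proof -
  obtain \<nu> where \<xi>: "\<xi> = {y. \<exists>k::int. \<nu> - y = 2 * of_int k}"
    using assms(1) by (auto simp: C_mod_2Z_def quotient_def)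
  obtain k :: int where "\<nu> - \<mu> = 2 * of_int k" using assms(2) \<xi> by auto
  then have "\<nu> - (\<mu> - 2) = 2 * of_int (k + 1)" by (simp add: algebra_simps)
  then show ?thesis unfolding \<xi> by blast
qed

lemma generic_block_of_M_bar:
  assumes "\<xi> \<in> C_mod_2Z" "\<forall>\<mu>\<in>\<xi>. s\<^sup>2 \<noteq> (\<mu> + 1)\<^sup>2" "s\<^sup>2 \<noteq> 0" "M \<in> Ob (M_bar \<xi> (s\<^sup>2))"
  shows "generic_block M \<xi> s"
  using assms C_mod_2Z_shift[OF assms(1)]
  by unfold_locales (auto simp: M_bar_def full_subcategory_def lie_mod_def casimir_shift_def)

text \<open>
  From right to left this is \<open>hom_witt_act\<close>; the converse inclusion is the functoriality of restriction,
  as restriction gives back the original modules.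
\<close>

lemma rep_homs_witt_rep:
  assumes "generic_block M \<xi> s" "generic_block N \<xi> s"
  shows "rep_homs witt (on_ob (witt_functor s) M) (on_ob (witt_functor s) N) = rep_homs sl2 M N"
proof (intro equalityI subsetI)
  interpret M: generic_block M \<xi> s by fact
  interpret N: generic_block N \<xi> s by fact
  fix \<phi> assume "\<phi> \<in> rep_homs witt (on_ob (witt_functor s) M) (on_ob (witt_functor s) N)"
  then have "on_hom forget_functor (witt_rep M M.L) (witt_rep N N.L) \<phi>
      \<in> Hom (lie_mod sl2) (on_ob forget_functor (witt_rep M M.L)) (on_ob forget_functor (witt_rep N N.L))"
    using is_functor_forget M.is_lie_rep_witt_rep N.is_lie_rep_witt_rep
    by (auto simp: is_functor_def lie_mod_def witt_functor_def)
  then show "\<phi> \<in> rep_homs sl2 M N"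
    unfolding M.restrict_witt_rep N.restrict_witt_rep
    by (simp add: forget_functor_def restriction_functor_def lie_mod_def)
next
  fix \<phi> assume \<phi>: "\<phi> \<in> rep_homs sl2 M N"
  interpret generic_block_hom M N \<xi> s \<phi>
    using assms \<phi> by (simp add: generic_block_hom_def generic_block_hom_axioms_def)
  show "\<phi> \<in> rep_homs witt (on_ob (witt_functor s) M) (on_ob (witt_functor s) N)"
    using \<phi> hom_witt_act by (auto simp: rep_homs_def witt_functor_def)
qed

theorem theorem4p6:
  fixes \<xi> :: "complex set" and \<tau> :: complex
  assumes "\<xi> \<in> C_mod_2Z"
    and "\<forall>\<mu>\<in>\<xi>. \<tau> \<noteq> (\<mu> + 1)\<^sup>2"
    and "\<tau> \<noteq> 0"
  shows "\<exists>F :: complex \<Rightarrow> ((complex^2^2, 'v) lie_rep, 'v \<Rightarrow> 'v,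
                           (int \<Rightarrow>\<^sub>0 complex, 'v) lie_rep, 'v \<Rightarrow> 'v) ftor.
           \<forall>s. s\<^sup>2 = \<tau> \<longrightarrow>
             is_functor (M_bar \<xi> \<tau>) (lie_mod witt) (F s) \<and>
             fully_faithful (M_bar \<xi> \<tau>) (lie_mod witt) (F s) \<and>
             functor_eq (M_bar \<xi> \<tau>) (functor_comp forget_functor (F s)) inclusion_functor"
proof (intro exI[of _ witt_functor] allI impI)
  fix s :: complex assume s: "s\<^sup>2 = \<tau>"
  let ?C = "M_bar \<xi> \<tau> :: ((complex^2^2, 'v) lie_rep, 'v \<Rightarrow> 'v) category"
  have gb: "generic_block M \<xi> s" if "M \<in> Ob ?C" for M :: "(complex^2^2, 'v) lie_rep"
    using generic_block_of_M_bar[of \<xi> s M] assms that s by simp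
  have homs: "Hom (lie_mod witt) (on_ob (witt_functor s) M) (on_ob (witt_functor s) N) = Hom ?C M N"
    if "M \<in> Ob ?C" "N \<in> Ob ?C" for M N
    using rep_homs_witt_rep[OF gb[OF that(1)] gb[OF that(2)]]
    by (simp add: M_bar_def full_subcategory_def lie_mod_def)
  have ob: "is_lie_rep witt (on_ob (witt_functor s) M)" "on_ob forget_functor (on_ob (witt_functor s) M) = M"
    if "M \<in> Ob ?C" for M :: "(complex^2^2, 'v) lie_rep"
  proof -
    interpret generic_block M \<xi> s using gb[OF that] .
    show "is_lie_rep witt (on_ob (witt_functor s) M)"
      using is_lie_rep_witt_rep by (simp add: witt_functor_def)
    show "on_ob forget_functor (on_ob (witt_functor s) M) = M"
      using restrict_witt_rep by (simp add: witt_functor_def)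
  qed
  have carr: "carrier (on_ob (witt_functor s) M) = carrier M" for M :: "(complex^2^2, 'v) lie_rep"
    by (simp add: witt_functor_def)
  have hom_id: "on_hom (witt_functor s) M N \<phi> = \<phi>" for M N :: "(complex^2^2, 'v) lie_rep" and \<phi>
    by (simp add: witt_functor_def)
  have "is_functor ?C (lie_mod witt) (witt_functor s)"
    unfolding is_functor_def
    using homs ob(1) by (simp add: hom_id) (simp add: M_bar_def full_subcategory_def lie_mod_def carr)
  moreover have "fully_faithful ?C (lie_mod witt) (witt_functor s)"
    unfolding fully_faithful_def using homs by (auto simp: hom_id bij_betw_def inj_on_def)
  moreover have "functor_eq ?C (functor_comp forget_functor (witt_functor s)) inclusion_functor"
    unfolding functor_eq_def using ob(2)
    by (simp add: functor_comp_def inclusion_functor_def hom_id)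
       (simp add: forget_functor_def restriction_functor_def)
  ultimately show "is_functor ?C (lie_mod witt) (witt_functor s) \<and>
      fully_faithful ?C (lie_mod witt) (witt_functor s) \<and>
      functor_eq ?C (functor_comp forget_functor (witt_functor s)) inclusion_functor"
    by blast
qed

end
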